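(* Let $\Gamma=(V,E,s,r)$ be a row-finite graph and $F$ a field. Then the center $Z(L(\Gamma))$ of the Leavitt path algebra $L(\Gamma)$ over $F$ is the sum of the subspaces of the following types: (a) $F\,e(W)$, where $W$ runs over the finite hereditary finitary nonempty subsets of $V$ and $e(W)=\sum_{p\in Arr(W)}pp^{*}$; (b) the $F$-span of $\Big\{\sum_{p\in Arr(C)}pzp^{*}\ \Big|\ z\in Z(L(C))\Big\}$, where $C$ runs over the NE-cycles that are finitary in $\Gamma$.
   Context: A (directed) graph $\Gamma=(V,E,s,r)$ consists of a set $V$ of vertices, a set $E$ of edges and maps $s,r:E\to V$ (source and range); it is row-finite if $s^{-1}(v)$ is finite for every $v\in V$ ($V$ may be infinite). A sink is a vertex $v$ with $s^{-1}(v)=\emptyset$. A path of length $n\ge 1$ is a sequence $p=e_1\cdots e_n$ of edges with $r(e_i)=s(e_{i+1})$ for $1\le i<n$; $s(p)=s(e_1)$, $r(p)=r(e_n)$. Each vertex $v$ is a path of length $0$ with source and range $v$. A vertex $w$ is a descendant of $v$ if there is a path from $v$ to $w$. A subset $W\subseteq V$ is hereditary if all descendants of vertices of $W$ lie in $W$. A cycle is a path $C=e_1\cdots e_n$, $n\ge1$, with $s(C)=r(C)$ and $s(e_1),\dots,s(e_n)$ distinct; $V(C)=\{s(e_1),\dots,s(e_n)\}$, $E(C)=\{e_1,\dots,e_n\}$. An exit of $C$ is an edge $e\notin E(C)$ with $s(e)\in V(C)$; an NE-cycle is a cycle without exits (then $V(C)$ is hereditary). For nonempty $W\subseteq V$,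 an arrival path in $W$ is a path $p=e_1\cdots e_n$ with $r(p)\in W$ and $s(e_1),\dots,s(e_n)\notin W$; each $w\in W$ is an arrival path of length $0$. $Arr(W)$ is the set of arrival paths in $W$. A hereditary subset $W$ is finitary if $|Arr(W)|<\infty$. For an NE-cycle $C$, $Arr(C)=Arr(V(C))$, and $C$ is finitary if $V(C)$ is finitary. The Leavitt path algebra $L(\Gamma)$ over $F$ is the (not necessarily unital) $F$-algebra presented by generators $v$ ($v\in V$), $e,e^{*}$ ($e\in E$) and relations: (1) $vw=\delta_{v,w}v$; (2) $s(e)e=er(e)=e$, $r(e)e^{*}=e^{*}s(e)=e^{*}$; (3) $e^{*}f=\delta_{e,f}r(e)$; (4) $v=\sum_{s(e)=v}ee^{*}$ for every $v$ that is not a sink. For a path $p=e_1\cdots e_n$, $p^{*}=e_n^{*}\cdots e_1^{*}$; $v^*=v$ for $v\in V$. For an NE-cycle $C$, $L(C)=L(V(C))$ is the subalgebra of $L(\Gamma)$ generated by $V(C)$ and by all $e,e^{*}$ with $e$ an edge having source and range in $V(C)$; $Z(\cdot)$ denotes the center. *)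

theory Defs
  imports
    "HOL-Algebra.Module"
    "HOL-Library.Multiset"
    "HOL-Library.Poly_Mapping"
    "Graph_Theory.Arc_Walk"
begin

text \<open>
  Graphs are the possibly infinite directed multigraphs of the locale \<^locale>\<open>wf_digraph\<close>, with
  source \<^const>\<open>tail\<close> and range \<^const>\<open>head\<close>.  A path is a pair \<open>(u, p)\<close> of its source and its list of
  edges, so that the path of length \<open>0\<close> at \<open>v\<close> is \<open>(v, [])\<close>; \<open>awalk u p w\<close> says that \<open>(u, p)\<close> is a
  path from \<open>u\<close> to \<open>w\<close>.
\<close>

definition row_finite :: "('v, 'e) pre_digraph \<Rightarrow> bool" where
  "row_finite G \<longleftrightarrow> (\<forall>v\<in>verts G. finite (out_arcs G v))"

definition hereditary :: "('v, 'e) pre_digraph \<Rightarrow> 'v set \<Rightarrow> bool" where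
  "hereditary G W \<longleftrightarrow>
     W \<subseteq> verts G \<and> (\<forall>u\<in>W. \<forall>p w. pre_digraph.awalk G u p w \<longrightarrow> w \<in> W)"

definition Arr :: "('v, 'e) pre_digraph \<Rightarrow> 'v set \<Rightarrow> ('v \<times> 'e list) set" where
  "Arr G W = {(u, p). \<exists>w\<in>W. pre_digraph.awalk G u p w \<and> (\<forall>e\<in>set p. tail G e \<notin> W)}"

definition finitary :: "('v, 'e) pre_digraph \<Rightarrow> 'v set \<Rightarrow> bool" where
  "finitary G W \<longleftrightarrow> hereditary G W \<and> finite (Arr G W)"

definition cycle_verts :: "('v, 'e) pre_digraph \<Rightarrow> 'e list \<Rightarrow> 'v set" where
  "cycle_verts G C = tail G ` set C"

text \<open>
  The library's \<open>cycle\<close> asks for distinct ranges of the edges instead of distinct sources.  On a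
  closed path the ranges are the sources rotated by one position, so this is the same condition.
\<close>

lemma cycle_iff_distinct_sources:
  "pre_digraph.cycle G C \<longleftrightarrow>
     (\<exists>u. pre_digraph.awalk G u C u) \<and> C \<noteq> [] \<and> distinct (map (tail G) C)"
proof -
  have last: "last (pre_digraph.awalk_verts G u p) = w" if "pre_digraph.cas G u p w" for u p w
    using that
    by (induction p arbitrary: u)
      (auto simp: pre_digraph.cas.simps pre_digraph.awalk_verts.simps
        pre_digraph.awalk_verts_non_Nil)
  have "distinct (tl (pre_digraph.awalk_verts G u C)) \<longleftrightarrow> distinct (map (tail G) C)"
    if "pre_digraph.awalk G u C u" "C \<noteq> []" for u
  proof -
    have cas: "pre_digraph.cas G u C u"
      using that by (simp add: pre_digraph.awalk_def)
    have sources: "pre_digraph.awalk_verts G u C = map (tail G) C @ [u]"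
      using that last[OF cas] by (simp add: pre_digraph.awalk_verts_conv)
    have "tail G (hd C) = u"
      using cas that by (simp add: pre_digraph.cas_simp)
    then have ranges: "pre_digraph.awalk_verts G u C = u # map (head G) C"
      using that pre_digraph.awalk_verts_conv'[OF cas] by simp
    have "mset (u # map (head G) C) = mset (map (tail G) C @ [u])"
      using sources ranges by simp
    then have "mset (map (head G) C) = mset (map (tail G) C)"
      by simp
    then show ?thesis
      using ranges by (metis list.sel(3) mset_eq_imp_distinct_iff)
  qed
  then show ?thesis
    by (auto simp: pre_digraph.cycle_def)
qed

definition NE_cycle :: "('v, 'e) pre_digraph \<Rightarrow> 'e list \<Rightarrow> bool" where
  "NE_cycle G C \<longleftrightarrow> pre_digraph.cycle G C \<and>
     \<not> (\<exists>e\<in>arcs G. e \<notin> set C \<and> tail G e \<in> cycle_verts G C)"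

text \<open>
  The free associative algebra on a type of generators is the monoid algebra of the free monoid;
  the wrapper type only serves to give lists their monoid structure.
\<close>

datatype 'x free_monoid = Word (letters: "'x list")

instantiation free_monoid :: (type) monoid_add
begin

definition zero_free_monoid :: "'a free_monoid" where
  "0 = Word []"

definition plus_free_monoid :: "'a free_monoid \<Rightarrow> 'a free_monoid \<Rightarrow> 'a free_monoid" where
  "v + w = Word (letters v @ letters w)"

instance
  by standard (auto simp: zero_free_monoid_def plus_free_monoid_def)

end

type_synonym ('x, 'f) free_algebra = "'x free_monoid \<Rightarrow>\<^sub>0 'f"

definition monomial :: "'x list \<Rightarrow> ('x, 'f::field) free_algebra" where
  "monomial ws = Poly_Mapping.single (Word ws) 1"

definition scalar :: "'f::field \<Rightarrow> ('x, 'f) free_algebra" where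
  "scalar c = Poly_Mapping.single 0 c"

text \<open>The free non-unital algebra on \<open>X\<close>: no constant terms.\<close>

definition free_nonunital :: "'x set \<Rightarrow> ('x, 'f::field) free_algebra set" where
  "free_nonunital X = {a. \<forall>w\<in>Poly_Mapping.keys a. letters w \<noteq> [] \<and> set (letters w) \<subseteq> X}"

inductive_set ideal_generated ::
    "'x set \<Rightarrow> ('x, 'f::field) free_algebra set \<Rightarrow> ('x, 'f) free_algebra set"
  for X :: "'x set" and R :: "('x, 'f) free_algebra set" where
  zero: "0 \<in> ideal_generated X R"
| incl: "r \<in> R \<Longrightarrow> r \<in> ideal_generated X R"
| add: "a \<in> ideal_generated X R \<Longrightarrow> b \<in> ideal_generated X R \<Longrightarrow> a + b \<in> ideal_generated X R"
| smult: "a \<in> ideal_generated X R \<Longrightarrow> scalar c * a \<in> ideal_generated X R"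
| lmult: "a \<in> ideal_generated X R \<Longrightarrow> x \<in> free_nonunital X \<Longrightarrow> x * a \<in> ideal_generated X R"
| rmult: "a \<in> ideal_generated X R \<Longrightarrow> x \<in> free_nonunital X \<Longrightarrow> a * x \<in> ideal_generated X R"

datatype ('v, 'e) generator = Vertex 'v | Edge 'e | Ghost 'e

definition generators :: "('v, 'e) pre_digraph \<Rightarrow> ('v, 'e) generator set" where
  "generators G = Vertex ` verts G \<union> Edge ` arcs G \<union> Ghost ` arcs G"

text \<open>
  The sum in the last family is meant for row-finite graphs; over an infinite set it would be \<open>0\<close>.
\<close>

definition leavitt_relations ::
    "('v, 'e) pre_digraph \<Rightarrow> (('v, 'e) generator, 'f::field) free_algebra set" where
  "leavitt_relations G =
     {monomial [Vertex v, Vertex w] - (if v = w then monomial [Vertex v] else 0) | v w.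
        v \<in> verts G \<and> w \<in> verts G}
   \<union> {monomial [Vertex (tail G e), Edge e] - monomial [Edge e] | e. e \<in> arcs G}
   \<union> {monomial [Edge e, Vertex (head G e)] - monomial [Edge e] | e. e \<in> arcs G}
   \<union> {monomial [Vertex (head G e), Ghost e] - monomial [Ghost e] | e. e \<in> arcs G}
   \<union> {monomial [Ghost e, Vertex (tail G e)] - monomial [Ghost e] | e. e \<in> arcs G}
   \<union> {monomial [Ghost e, Edge f] - (if e = f then monomial [Vertex (head G e)] else 0) | e f.
        e \<in> arcs G \<and> f \<in> arcs G}
   \<union> {monomial [Vertex v] - (\<Sum>e\<in>out_arcs G v. monomial [Edge e, Ghost e]) | v.
        v \<in> verts G \<and> out_arcs G v \<noteq> {}}"

definition leavitt_class ::
    "('v, 'e) pre_digraph \<Rightarrow> (('v, 'e) generator, 'f::field) free_algebra \<Rightarrow>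
      (('v, 'e) generator, 'f) free_algebra set" where
  "leavitt_class G a = {b. b - a \<in> ideal_generated (generators G) (leavitt_relations G)}"

text \<open>
  The Leavitt path algebra as a quotient of the free non-unital algebra.  It need not have an
  identity; the \<open>one\<close> field of the record type is a dummy.
\<close>

definition leavitt ::
    "('v, 'e) pre_digraph \<Rightarrow> ('f::field, (('v, 'e) generator, 'f) free_algebra set) module" where
  "leavitt G =
     \<lparr>carrier = leavitt_class G ` free_nonunital (generators G),
      monoid.mult = (\<lambda>A B. \<Union>a\<in>A. \<Union>b\<in>B. leavitt_class G (a * b)),
      one = undefined,
      zero = leavitt_class G 0,
      add = (\<lambda>A B. \<Union>a\<in>A. \<Union>b\<in>B. leavitt_class G (a + b)),
      smult = (\<lambda>c A. \<Union>a\<in>A. leavitt_class G (scalar c * a))\<rparr>"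

lemma free_nonunital_zero: "0 \<in> free_nonunital X"
  by (simp add: free_nonunital_def)

lemma free_nonunital_add:
  "a \<in> free_nonunital X \<Longrightarrow> b \<in> free_nonunital X \<Longrightarrow> a + b \<in> free_nonunital X"
  unfolding free_nonunital_def using Poly_Mapping.keys_add[of a b] by blast

lemma free_nonunital_mult:
  assumes "a \<in> free_nonunital X" "b \<in> free_nonunital X"
  shows "a * b \<in> free_nonunital X"
  unfolding free_nonunital_def
proof (intro CollectI ballI)
  fix w assume "w \<in> Poly_Mapping.keys (a * b)"
  then obtain u v where "u \<in> Poly_Mapping.keys a" "v \<in> Poly_Mapping.keys b" "w = u + v"
    using Poly_Mapping.keys_mult[of a b] by blast
  then show "letters w \<noteq> [] \<and> set (letters w) \<subseteq> X"
    using assms by (auto simp: free_nonunital_def plus_free_monoid_def)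
qed

lemma free_nonunital_scalar:
  assumes "a \<in> free_nonunital X"
  shows "scalar c * a \<in> free_nonunital X"
  unfolding free_nonunital_def
proof (intro CollectI ballI)
  fix w assume "w \<in> Poly_Mapping.keys (scalar c * a)"
  then obtain u v where "u \<in> Poly_Mapping.keys (scalar c)" "v \<in> Poly_Mapping.keys a" "w = u + v"
    using Poly_Mapping.keys_mult[of "scalar c" a] by blast
  then show "letters w \<noteq> [] \<and> set (letters w) \<subseteq> X"
    using assms by (auto simp: free_nonunital_def scalar_def split: if_splits)
qed

lemma scalar_minus_one: "scalar (- 1) * a = - a"
  by (simp add: scalar_def single_uminus)

lemma free_nonunital_uminus: "a \<in> free_nonunital X \<Longrightarrow> - a \<in> free_nonunital X"
  using free_nonunital_scalar[of a X "- 1"] by (simp add: scalar_minus_one)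

lemma free_nonunital_diff:
  "a \<in> free_nonunital X \<Longrightarrow> b \<in> free_nonunital X \<Longrightarrow> a - b \<in> free_nonunital X"
  using free_nonunital_add[OF _ free_nonunital_uminus, of a X b] by simp

lemma free_nonunital_sum:
  "(\<And>i. i \<in> I \<Longrightarrow> f i \<in> free_nonunital X) \<Longrightarrow> sum f I \<in> free_nonunital X"
  by (induction I rule: infinite_finite_induct)
    (auto intro: free_nonunital_add free_nonunital_zero)

lemma free_nonunital_monomial:
  "ws \<noteq> [] \<Longrightarrow> set ws \<subseteq> X \<Longrightarrow> monomial ws \<in> free_nonunital X"
  by (simp add: free_nonunital_def monomial_def)

lemma ideal_generated_diff:
  assumes "a \<in> ideal_generated X R" "b \<in> ideal_generated X R"
  shows "a - b \<in> ideal_generated X R"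
  using ideal_generated.add[OF assms(1) ideal_generated.smult[OF assms(2), of "- 1"]]
  by (simp add: scalar_minus_one)

lemma ideal_generated_subset:
  assumes "R \<subseteq> free_nonunital X"
  shows "ideal_generated X R \<subseteq> free_nonunital X"
proof
  fix a assume "a \<in> ideal_generated X R"
  then show "a \<in> free_nonunital X"
    using assms
    by induction
      (auto intro: free_nonunital_zero free_nonunital_add free_nonunital_mult
        free_nonunital_scalar)
qed

lemma leavitt_relations_subset:
  assumes "wf_digraph G"
  shows "leavitt_relations G \<subseteq> free_nonunital (generators G)"
proof -
  interpret wf_digraph G by fact
  show ?thesis
    unfolding leavitt_relations_def
    by (auto intro!: free_nonunital_diff free_nonunital_sum free_nonunital_monomial
        free_nonunital_zero simp: generators_def out_arcs_def)
qed

lemma leavitt_class_refl: "a \<in> leavitt_class G a"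
  by (simp add: leavitt_class_def ideal_generated.zero)

lemma leavitt_class_eq_iff:
  "leavitt_class G a = leavitt_class G b \<longleftrightarrow>
     a - b \<in> ideal_generated (generators G) (leavitt_relations G)"
proof
  assume "leavitt_class G a = leavitt_class G b"
  then show "a - b \<in> ideal_generated (generators G) (leavitt_relations G)"
    using leavitt_class_refl[of a G] by (simp add: leavitt_class_def)
next
  assume "a - b \<in> ideal_generated (generators G) (leavitt_relations G)"
  then show "leavitt_class G a = leavitt_class G b"
    unfolding leavitt_class_def
    using ideal_generated.add[of _ _ _ "a - b"] ideal_generated_diff[of _ _ _ "a - b"]
    by (auto simp: algebra_simps) (smt (verit) add_diff_cancel_left' diff_add_cancel diff_diff_eq2)+
qed

text \<open>The operations of \<^const>\<open>leavitt\<close> are those of representatives.\<close>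

lemma leavitt_carrier: "carrier (leavitt G) = leavitt_class G ` free_nonunital (generators G)"
  and leavitt_zero: "\<zero>\<^bsub>leavitt G\<^esub> = leavitt_class G 0"
  by (simp_all add: leavitt_def)

lemma leavitt_add:
  "leavitt_class G a \<oplus>\<^bsub>leavitt G\<^esub> leavitt_class G b = leavitt_class G (a + b)"
proof -
  have "leavitt_class G (a' + b') = leavitt_class G (a + b)"
    if "a' \<in> leavitt_class G a" "b' \<in> leavitt_class G b" for a' b'
  proof -
    have "a' + b' - (a + b) = (a' - a) + (b' - b)"
      by simp
    then show ?thesis
      using that unfolding leavitt_class_eq_iff
      by (simp only: leavitt_class_def mem_Collect_eq ideal_generated.add)
  qed
  then show ?thesis
    unfolding leavitt_def using leavitt_class_refl by (simp, blast)
qed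

lemma leavitt_smult:
  "c \<odot>\<^bsub>leavitt G\<^esub> leavitt_class G a = leavitt_class G (scalar c * a)"
proof -
  have "leavitt_class G (scalar c * a') = leavitt_class G (scalar c * a)"
    if "a' \<in> leavitt_class G a" for a'
    using that ideal_generated.smult[of "a' - a" _ _ c] unfolding leavitt_class_eq_iff
    by (simp add: leavitt_class_def right_diff_distrib)
  then show ?thesis
    unfolding leavitt_def using leavitt_class_refl by (simp, blast)
qed

lemma leavitt_mult:
  assumes "wf_digraph G" "a \<in> free_nonunital (generators G)" "b \<in> free_nonunital (generators G)"
  shows "leavitt_class G a \<otimes>\<^bsub>leavitt G\<^esub> leavitt_class G b = leavitt_class G (a * b)"
proof -
  have "leavitt_class G (a' * b') = leavitt_class G (a * b)"
    if "a' \<in> leavitt_class G a" "b' \<in> leavitt_class G b" for a' b'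
  proof -
    have a': "a' - a \<in> ideal_generated (generators G) (leavitt_relations G)"
      and b': "b' - b \<in> ideal_generated (generators G) (leavitt_relations G)"
      using that by (simp_all add: leavitt_class_def)
    have "b' - b \<in> free_nonunital (generators G)"
      using b' ideal_generated_subset[OF leavitt_relations_subset[OF assms(1)]] by blast
    then have "b' \<in> free_nonunital (generators G)"
      using free_nonunital_add[OF _ assms(3)] by force
    then have "(a' - a) * b' + a * (b' - b) \<in> ideal_generated (generators G) (leavitt_relations G)"
      by (intro ideal_generated.add ideal_generated.rmult ideal_generated.lmult a' b' assms)
    then show ?thesis
      by (simp add: leavitt_class_eq_iff algebra_simps)
  qed
  then show ?thesis
    unfolding leavitt_def using leavitt_class_refl by (simp, blast)
qed

lemma abelian_group_leavitt: "abelian_group (leavitt G)"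
proof (rule abelian_groupI)
  fix x assume "x \<in> carrier (leavitt G)"
  then obtain a where a: "x = leavitt_class G a" "a \<in> free_nonunital (generators G)"
    by (auto simp: leavitt_carrier)
  then have "leavitt_class G (- a) \<oplus>\<^bsub>leavitt G\<^esub> x = \<zero>\<^bsub>leavitt G\<^esub>"
    by (simp add: leavitt_add leavitt_zero)
  moreover have "leavitt_class G (- a) \<in> carrier (leavitt G)"
    using a by (simp add: leavitt_carrier free_nonunital_uminus)
  ultimately show "\<exists>y\<in>carrier (leavitt G). y \<oplus>\<^bsub>leavitt G\<^esub> x = \<zero>\<^bsub>leavitt G\<^esub>"
    by blast
qed (auto simp: leavitt_carrier leavitt_zero leavitt_add ac_simps
    intro: free_nonunital_zero free_nonunital_add)

fun path_elem :: "('v, 'e) pre_digraph \<Rightarrow> 'v \<times> 'e list \<Rightarrow>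
    (('v, 'e) generator, 'f::field) free_algebra set" where
  "path_elem G (u, p) =
     leavitt_class G (monomial (if p = [] then [Vertex u] else map Edge p))"

fun path_star :: "('v, 'e) pre_digraph \<Rightarrow> 'v \<times> 'e list \<Rightarrow>
    (('v, 'e) generator, 'f::field) free_algebra set" where
  "path_star G (u, p) =
     leavitt_class G (monomial (if p = [] then [Vertex u] else map Ghost (rev p)))"

definition center :: "('f, 'a) module \<Rightarrow> 'a set" where
  "center A = {z \<in> carrier A. \<forall>x\<in>carrier A. z \<otimes>\<^bsub>A\<^esub> x = x \<otimes>\<^bsub>A\<^esub> z}"

inductive_set subalgebra_generated :: "('f, 'a) module \<Rightarrow> 'a set \<Rightarrow> 'a set"
  for A :: "('f, 'a) module" and S :: "'a set" where
  zero: "\<zero>\<^bsub>A\<^esub> \<in> subalgebra_generated A S"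
| incl: "x \<in> S \<Longrightarrow> x \<in> subalgebra_generated A S"
| add: "x \<in> subalgebra_generated A S \<Longrightarrow> y \<in> subalgebra_generated A S \<Longrightarrow>
    x \<oplus>\<^bsub>A\<^esub> y \<in> subalgebra_generated A S"
| smult: "x \<in> subalgebra_generated A S \<Longrightarrow> c \<odot>\<^bsub>A\<^esub> x \<in> subalgebra_generated A S"
| mult: "x \<in> subalgebra_generated A S \<Longrightarrow> y \<in> subalgebra_generated A S \<Longrightarrow>
    x \<otimes>\<^bsub>A\<^esub> y \<in> subalgebra_generated A S"

inductive_set linear_span :: "('f, 'a) module \<Rightarrow> 'a set \<Rightarrow> 'a set"
  for A :: "('f, 'a) module" and S :: "'a set" where
  zero: "\<zero>\<^bsub>A\<^esub> \<in> linear_span A S"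
| incl: "x \<in> S \<Longrightarrow> x \<in> linear_span A S"
| add: "x \<in> linear_span A S \<Longrightarrow> y \<in> linear_span A S \<Longrightarrow> x \<oplus>\<^bsub>A\<^esub> y \<in> linear_span A S"
| smult: "x \<in> linear_span A S \<Longrightarrow> c \<odot>\<^bsub>A\<^esub> x \<in> linear_span A S"

definition subspace_sum :: "('f, 'a) module \<Rightarrow> 'a set set \<Rightarrow> 'a set" where
  "subspace_sum A \<U> = linear_span A (\<Union>\<U>)"

text \<open>\<open>L(W)\<close>, regarded as an algebra in its own right.\<close>

definition leavitt_sub :: "('v, 'e) pre_digraph \<Rightarrow> 'v set \<Rightarrow>
    ('f::field, (('v, 'e) generator, 'f) free_algebra set) module" where
  "leavitt_sub G W = (leavitt G)\<lparr>carrier := subalgebra_generated (leavitt G)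
     (leavitt_class G ` monomial ` (\<lambda>g. [g]) `
       (Vertex ` W \<union> (\<Union>e\<in>{e \<in> arcs G. tail G e \<in> W \<and> head G e \<in> W}. {Edge e, Ghost e})))\<rparr>"

definition arrival_idempotent :: "('v, 'e) pre_digraph \<Rightarrow> 'v set \<Rightarrow>
    (('v, 'e) generator, 'f::field) free_algebra set" where
  "arrival_idempotent G W =
     (\<Oplus>\<^bsub>leavitt G\<^esub> p\<in>Arr G W. path_elem G p \<otimes>\<^bsub>leavitt G\<^esub> path_star G p)"

end

theory Submission
  imports Defs "HOL-Library.Countable_Set"
begin

text \<open>
  Let \<open>z\<close> be central and put \<open>z\<^sub>v = v z = v z v\<close>.  Commuting \<open>z\<close> past an edge \<open>e\<close> from \<open>v\<close> to \<open>w\<close> gives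
  \<open>z\<^sub>w = e\<^sup>* z\<^sub>v e\<close>, and \<open>z\<^sub>v = \<Sum> e z\<^sub>r\<^sub>(\<^sub>e\<^sub>) e\<^sup>*\<close> if \<open>v\<close> is not a sink.  So the value at a vertex determines the
  values at its descendants, a scalar value \<open>z\<^sub>v = c v\<close> is inherited by all descendants of \<open>v\<close>, and the
  support \<open>{v. z\<^sub>v \<noteq> 0}\<close>, which is finite, contains with a vertex all vertices that lead to it.
  
  The local facts are that \<open>z\<^sub>v\<close> is scalar if \<open>v\<close> is a sink (\<open>corner_at_sink\<close>) and if \<open>v\<close> lies on a
  cycle with an exit (\<open>scalar_on_cycle\<close>).  In the second case \<open>z\<^sub>v\<close> is, up to multiplication by a power of
  the cycle \<open>C\<close>, a polynomial in \<open>C\<close>, and an exit \<open>f\<close> tells the powers of \<open>C\<close> apart because \<open>f\<^sup>* C = 0\<close>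
  and \<open>C\<^sup>* f = 0\<close>.
  
  A nonempty finite support contains a sink or a cycle: otherwise walks inside it could be prolonged
  beyond its size.  So there is in the support either a scalar vertex, with some scalar \<open>c\<close>, or else a
  cycle without exits.  Let \<open>W\<close> be the set of all \<open>v\<close> with \<open>z\<^sub>v = c v\<close>, or the set of vertices of the cycle.
  It is hereditary, and it is finitary: a very long path arriving in \<open>W\<close> would pass through a cycle of
  the support outside \<open>W\<close>, which must have an exit in order to reach \<open>W\<close>, and on which \<open>z\<close> is
  therefore scalar, with a scalar that \<open>W\<close> inherits; by the choice of \<open>W\<close> such a cycle lies in \<open>W\<close>
  or does not exist (\<open>finite_Arr_of_support\<close>).  Now \<open>z e(W) = \<Sum> p z p\<^sup>*\<close> over the arrival paths in \<open>W\<close> is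
  a generator of type (a) times a scalar, or one of type (b), and \<open>z - z e(W)\<close> is central with smaller
  support.  Induction shows that \<open>z\<close> lies in the span (\<open>Z_subset_span\<close>).
  
  Conversely \<open>\<Sum> p z p\<^sup>*\<close> is central for every \<open>z\<close> in the center of \<open>L(W)\<close>, where \<open>W\<close> is hereditary and
  finitary: passing an edge \<open>e\<close> through the sum exchanges the arrival paths at \<open>r(e)\<close> with those at
  \<open>s(e)\<close> that begin with \<open>e\<close> (\<open>spread_commutes\<close>).  For the identity of \<open>L(W)\<close> this is the centrality of
  \<open>e(W)\<close>.
  
  The argument uses the relations and one more fact, that no vertex is \<open>0\<close> in the algebra.  It
  follows from a representation on functions (\<open>vertex_not_in_ideal\<close>).  The computations are made in
  the locale \<open>leavitt_family\<close>, for elements of a ring that satisfy the relations; the Leavitt path algebra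
  is such a family inside the product of all quotients of the free algebra.
\<close>

section \<open>All quotients of a ring in one type\<close>

definition two_sided_ideal :: "'a::ring_1 set \<Rightarrow> bool" where
  "two_sided_ideal J \<longleftrightarrow> 0 \<in> J \<and> (\<forall>a\<in>J. \<forall>b\<in>J. a + b \<in> J) \<and> (\<forall>a\<in>J. \<forall>x. x * a \<in> J \<and> a * x \<in> J)"

lemma two_sided_idealD:
  assumes "two_sided_ideal J"
  shows "0 \<in> J" "a \<in> J \<Longrightarrow> b \<in> J \<Longrightarrow> a + b \<in> J" "a \<in> J \<Longrightarrow> x * a \<in> J" "a \<in> J \<Longrightarrow> a * x \<in> J"
    "a \<in> J \<Longrightarrow> - a \<in> J" "a \<in> J \<Longrightarrow> b \<in> J \<Longrightarrow> a - b \<in> J"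
proof -
  have *: "- a \<in> J" if "a \<in> J" for a
  proof -
    have "(- 1) * a \<in> J"
      using assms that unfolding two_sided_ideal_def by blast
    then show ?thesis by simp
  qed
  show "a \<in> J \<Longrightarrow> - a \<in> J"
    by (rule *)
  show "a - b \<in> J" if "a \<in> J" "b \<in> J"
  proof -
    have "a + - b \<in> J"
      using assms that * unfolding two_sided_ideal_def by blast
    then show ?thesis by simp
  qed
qed (use assms in \<open>auto simp: two_sided_ideal_def\<close>)

definition congruent_mod_ideals :: "('a::ring_1 set \<Rightarrow> 'a) \<Rightarrow> ('a set \<Rightarrow> 'a) \<Rightarrow> bool" where
  "congruent_mod_ideals f g \<longleftrightarrow> (\<forall>J. two_sided_ideal J \<longrightarrow> f J - g J \<in> J)"

text \<open>
  The product of all quotient rings \<open>R/J\<close> of a ring \<open>R\<close>.  A quotient by one ideal depends on that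
  ideal, which is a term, and so is not a type; but it is a direct factor of this product, which is a
  type, and equations in \<open>R/J\<close> become equations in a genuine ring.
\<close>

quotient_type (overloaded) 'a quots = "'a::ring_1 set \<Rightarrow> 'a" / congruent_mod_ideals
proof (rule equivpI)
  show "reflp (congruent_mod_ideals :: ('a set \<Rightarrow> 'a) \<Rightarrow> _)"
    by (simp add: reflp_def congruent_mod_ideals_def two_sided_idealD)
  show "symp (congruent_mod_ideals :: ('a set \<Rightarrow> 'a) \<Rightarrow> _)"
    using two_sided_idealD(5) by (fastforce simp: symp_def congruent_mod_ideals_def)
  show "transp (congruent_mod_ideals :: ('a set \<Rightarrow> 'a) \<Rightarrow> _)"
    using two_sided_idealD(2) by (fastforce simp: transp_def congruent_mod_ideals_def)
qed

instantiation quots :: (ring_1) ring_1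
begin

lift_definition zero_quots :: "'a quots" is "\<lambda>_. 0" .
lift_definition one_quots :: "'a quots" is "\<lambda>_. 1" .

lift_definition plus_quots :: "'a quots \<Rightarrow> 'a quots \<Rightarrow> 'a quots" is "\<lambda>f g J. f J + g J"
  by (simp add: congruent_mod_ideals_def add_diff_add two_sided_idealD(2))

lift_definition uminus_quots :: "'a quots \<Rightarrow> 'a quots" is "\<lambda>f J. - f J"
  using two_sided_idealD(5) by (fastforce simp: congruent_mod_ideals_def)

lift_definition minus_quots :: "'a quots \<Rightarrow> 'a quots \<Rightarrow> 'a quots" is "\<lambda>f g J. f J - g J"
proof -
  fix f f' g g' :: "'a set \<Rightarrow> 'a"
  assume *: "congruent_mod_ideals f f'" "congruent_mod_ideals g g'"
  have "f J - g J - (f' J - g' J) = (f J - f' J) - (g J - g' J)" for J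
    by (simp add: algebra_simps)
  then show "congruent_mod_ideals (\<lambda>J. f J - g J) (\<lambda>J. f' J - g' J)"
    using * two_sided_idealD(6) unfolding congruent_mod_ideals_def by metis
qed

lift_definition times_quots :: "'a quots \<Rightarrow> 'a quots \<Rightarrow> 'a quots" is "\<lambda>f g J. f J * g J"
proof -
  fix f f' g g' :: "'a set \<Rightarrow> 'a"
  assume *: "congruent_mod_ideals f f'" "congruent_mod_ideals g g'"
  have "f J * g J - f' J * g' J = (f J - f' J) * g J + f' J * (g J - g' J)" for J
    by (simp add: algebra_simps)
  then show "congruent_mod_ideals (\<lambda>J. f J * g J) (\<lambda>J. f' J * g' J)"
    using * by (simp add: congruent_mod_ideals_def two_sided_idealD(2,3,4))
qed

instance
proof
  have "two_sided_ideal {0 :: 'a}"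
    by (simp add: two_sided_ideal_def)
  then show "(0 :: 'a quots) \<noteq> 1"
    by transfer (auto simp: congruent_mod_ideals_def)
qed (transfer; simp add: congruent_mod_ideals_def algebra_simps two_sided_idealD(1))+

end

lift_definition quots_const :: "'a::ring_1 \<Rightarrow> 'a quots" is "\<lambda>a _. a" .

text \<open>
  The factor \<open>R/J\<close> inside the product: all coordinates except the one at \<open>J\<close> are \<open>0\<close>, so the map
  preserves products but not the identity.  The constants embed \<open>R\<close> diagonally; on the factor \<open>R/J\<close>
  they act as the elements of \<open>R\<close> do.
\<close>

lift_definition quot_map :: "'a::ring_1 set \<Rightarrow> 'a \<Rightarrow> 'a quots" is
  "\<lambda>J a J'. if J' = J then a else 0" .

lemma quot_map_hom:
  "quot_map J 0 = 0"
  "quot_map J (a + b) = quot_map J a + quot_map J b"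
  "quot_map J (a - b) = quot_map J a - quot_map J b"
  "quot_map J (a * b) = quot_map J a * quot_map J b"
  "quot_map J (c * a) = quots_const c * quot_map J a"
  by (transfer; simp add: congruent_mod_ideals_def two_sided_idealD(1))+

lemma quot_map_sum: "quot_map J (sum f A) = (\<Sum>a\<in>A. quot_map J (f a))"
  by (induction A rule: infinite_finite_induct) (simp_all add: quot_map_hom)

lemma quot_map_eq_iff:
  assumes "two_sided_ideal J"
  shows "quot_map J a = quot_map J b \<longleftrightarrow> a - b \<in> J"
  using assms by transfer (auto simp: congruent_mod_ideals_def two_sided_idealD(1))

lemma quots_const_hom:
  "quots_const (a + b) = quots_const a + quots_const b"
  "quots_const (a * b) = quots_const a * quots_const b"
  "quots_const 1 = 1"
  by (transfer; simp add: congruent_mod_ideals_def two_sided_idealD(1))+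

lemma quots_const_central:
  assumes "\<And>a. c * a = a * c"
  shows "quots_const c * x = x * quots_const c"
  using assms by transfer (simp add: congruent_mod_ideals_def two_sided_idealD(1))

section \<open>Ideals of the free algebra\<close>

lemma free_algebra_induct [case_names single add]:
  fixes a :: "('x, 'f::field) free_algebra"
  assumes "\<And>w c. Q (Poly_Mapping.single w c)" "\<And>a b. Q a \<Longrightarrow> Q b \<Longrightarrow> Q (a + b)"
  shows "Q a"
proof (induction a rule: Poly_Mapping.update_induct)
  case const
  then show ?case using assms(1)[of undefined 0] by simp
next
  case (update a w c)
  then have "Poly_Mapping.update w c a = a + Poly_Mapping.single w c"
    by (intro poly_mapping_eqI)
      (auto simp: lookup_update lookup_add lookup_single in_keys_iff)
  then show ?case using update assms by simp
qed

lemma scalar_single_mult: "scalar c * Poly_Mapping.single w d = Poly_Mapping.single w (c * d)"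
  by (simp add: scalar_def mult_single)

lemma single_scalar_monomial: "Poly_Mapping.single w c = scalar c * monomial (letters w)"
  by (simp add: scalar_single_mult monomial_def)

lemma scalar_commute: "scalar c * a = a * scalar c"
  by (induction a rule: free_algebra_induct)
    (simp_all add: scalar_def mult_single algebra_simps)

lemma scalar_add: "scalar (a + b) = scalar a + scalar b"
  by (simp add: scalar_def single_add)

lemma scalar_mult: "scalar (a * b) = scalar a * scalar b"
  by (simp add: scalar_def mult_single)

lemma scalar_one: "scalar 1 = 1"
  by (simp add: scalar_def)

lemma monomial_mult: "monomial u * monomial v = monomial (u @ v)"
  by (simp add: monomial_def mult_single plus_free_monoid_def)

text \<open>
  An ideal of the free algebra on all letters, complementary to the free unital algebra on \<open>X\<close>.
\<close>

definition alien_words :: "'x set \<Rightarrow> ('x, 'f::field) free_algebra set" where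
  "alien_words X = {a. \<forall>w\<in>Poly_Mapping.keys a. \<not> set (letters w) \<subseteq> X}"

lemma alien_words_ideal: "two_sided_ideal (alien_words X)"
  unfolding two_sided_ideal_def alien_words_def
proof (intro conjI ballI allI CollectI)
  fix a b :: "('a, 'b) free_algebra" and w
  assume "a \<in> {a. \<forall>w\<in>Poly_Mapping.keys a. \<not> set (letters w) \<subseteq> X}"
    "b \<in> {a. \<forall>w\<in>Poly_Mapping.keys a. \<not> set (letters w) \<subseteq> X}" "w \<in> Poly_Mapping.keys (a + b)"
  then show "\<not> set (letters w) \<subseteq> X"
    using Poly_Mapping.keys_add[of a b] by blast
next
  fix a x :: "('a, 'b) free_algebra" and w
  assume "a \<in> {a. \<forall>w\<in>Poly_Mapping.keys a. \<not> set (letters w) \<subseteq> X}" 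
    and "w \<in> Poly_Mapping.keys (x * a)"
  moreover then obtain u v where "u \<in> Poly_Mapping.keys x" "v \<in> Poly_Mapping.keys a" "w = u + v"
    using Poly_Mapping.keys_mult[of x a] by blast
  ultimately show "\<not> set (letters w) \<subseteq> X"
    by (auto simp: plus_free_monoid_def)
next
  fix a x :: "('a, 'b) free_algebra" and w
  assume "a \<in> {a. \<forall>w\<in>Poly_Mapping.keys a. \<not> set (letters w) \<subseteq> X}" 
    and "w \<in> Poly_Mapping.keys (a * x)"
  moreover then obtain u v where "u \<in> Poly_Mapping.keys a" "v \<in> Poly_Mapping.keys x" "w = u + v"
    using Poly_Mapping.keys_mult[of a x] by blast
  ultimately show "\<not> set (letters w) \<subseteq> X"
    by (auto simp: plus_free_monoid_def)
qed auto

lemma free_algebra_decomp: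
  obtains c y k where "x = scalar c + y + k" "y \<in> free_nonunital X" "k \<in> alien_words X"
proof -
  have "\<exists>c y k. x = scalar c + y + k \<and> y \<in> free_nonunital X \<and> k \<in> alien_words X"
  proof (induction x rule: free_algebra_induct)
    case (single w c)
    have eq: "Poly_Mapping.single w c = scalar c + 0 + 0" if "letters w = []"
      using that by (cases w) (simp add: scalar_def zero_free_monoid_def)
    have "Poly_Mapping.single w c = scalar 0 + Poly_Mapping.single w c + 0"
       "Poly_Mapping.single w c = scalar 0 + 0 + Poly_Mapping.single w c"
      by (simp_all add: scalar_def)
    moreover have "0 \<in> alien_words X" "0 \<in> free_nonunital X"
      by (simp_all add: free_nonunital_zero alien_words_def)
    moreover have "Poly_Mapping.single w c \<in> alien_words X" if "\<not> set (letters w) \<subseteq> X"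
      using that by (simp add: alien_words_def)
    moreover have "Poly_Mapping.single w c \<in> free_nonunital X"
      if "set (letters w) \<subseteq> X" "letters w \<noteq> []"
      using that by (simp add: free_nonunital_def)
    ultimately show ?case using eq by blast
  next
    case (add a b)
    then obtain c y k c' y' k' where "a = scalar c + y + k" "y \<in> free_nonunital X" "k \<in> alien_words X"
      "b = scalar c' + y' + k'" "y' \<in> free_nonunital X" "k' \<in> alien_words X"
      by blast
    then have "a + b = scalar (c + c') + (y + y') + (k + k')" "y + y' \<in> free_nonunital X"
       "k + k' \<in> alien_words X"
      by (auto simp: scalar_add free_nonunital_add two_sided_idealD(2)[OF alien_words_ideal])
    then show ?case by blast
  qed
  then show ?thesis using that by blast
qed

text \<open>
  An ideal of the free algebra on \<open>X\<close> is not one of the free algebra on the whole type.  Adding the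
  alien words repairs this, and adds nothing new inside the free algebra on \<open>X\<close>.
\<close>

definition ideal_closure :: "'x set \<Rightarrow> ('x, 'f::field) free_algebra set \<Rightarrow> ('x, 'f) free_algebra set" where
  "ideal_closure X R = {i + k | i k. i \<in> ideal_generated X R \<and> k \<in> alien_words X}"

lemma two_sided_ideal_closure: "two_sided_ideal (ideal_closure X R)"
  unfolding two_sided_ideal_def
proof (intro conjI ballI allI)
  show "0 \<in> ideal_closure X R"
    unfolding ideal_closure_def
    by (force intro: ideal_generated.zero two_sided_idealD(1)[OF alien_words_ideal])
next
  fix a b :: "('a, 'b) free_algebra" assume "a \<in> ideal_closure X R" "b \<in> ideal_closure X R"
  then obtain i k i' k' where "a = i + k" "b = i' + k'" "i \<in> ideal_generated X R"
    "i' \<in> ideal_generated X R" "k \<in> alien_words X" "k' \<in> alien_words X"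
    unfolding ideal_closure_def by blast
  then have "a + b = (i + i') + (k + k')" "i + i' \<in> ideal_generated X R" "k + k' \<in> alien_words X"
    by (auto intro: ideal_generated.add two_sided_idealD(2)[OF alien_words_ideal])
  then show "a + b \<in> ideal_closure X R"
    unfolding ideal_closure_def by blast
next
  fix a x :: "('a, 'b) free_algebra" assume "a \<in> ideal_closure X R"
  then obtain i k where a: "a = i + k" "i \<in> ideal_generated X R" "k \<in> alien_words X"
    unfolding ideal_closure_def by blast
  obtain c y l where x: "x = scalar c + y + l" "y \<in> free_nonunital X" "l \<in> alien_words X"
    by (rule free_algebra_decomp)
  have "x * a = (scalar c * i + y * i) + (l * i + x * k)"
    unfolding a x by (simp add: algebra_simps)
  moreover have "a * x = (scalar c * i + i * y) + (i * l + k * x)"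
    unfolding a x using scalar_commute[of c i] by (simp add: algebra_simps)
  moreover have "scalar c * i + y * i \<in> ideal_generated X R" "scalar c * i + i * y \<in> ideal_generated X R"
    using a x by (auto intro: ideal_generated.intros)
  moreover have "l * i + x * k \<in> alien_words X" "i * l + k * x \<in> alien_words X"
    using a x by (auto intro!: two_sided_idealD(2)[OF alien_words_ideal]
        intro: two_sided_idealD(3,4)[OF alien_words_ideal])
  ultimately show "x * a \<in> ideal_closure X R" "a * x \<in> ideal_closure X R"
    unfolding ideal_closure_def by blast+
qed

lemma ideal_closure_Int_free_nonunital:
  assumes "R \<subseteq> free_nonunital X" "a \<in> free_nonunital X"
  shows "a \<in> ideal_closure X R \<longleftrightarrow> a \<in> ideal_generated X R"
proof
  assume "a \<in> ideal_closure X R"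
  then obtain i k where a: "a = i + k" "i \<in> ideal_generated X R" "k \<in> alien_words X"
    unfolding ideal_closure_def by blast
  then have "i \<in> free_nonunital X"
    using ideal_generated_subset[OF assms(1)] by blast
  then have "a - i \<in> free_nonunital X"
    using assms free_nonunital_diff by blast
  then have "Poly_Mapping.keys k = {}"
    using a by (auto simp: free_nonunital_def alien_words_def)
  then show "a \<in> ideal_generated X R"
    using a by simp
next
  assume "a \<in> ideal_generated X R"
  then show "a \<in> ideal_closure X R"
    unfolding ideal_closure_def by (force intro: two_sided_idealD(1)[OF alien_words_ideal])
qed

section \<open>A representation in which every vertex is nonzero\<close>

text \<open>
  The representation space has a copy of the natural numbers at each vertex.  The copy at \<open>v\<close> is to
  be the disjoint union, over the edges leaving \<open>v\<close>, of the copies at their ranges; a bijection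
  between \<open>\<nat>\<close> and finitely many copies of \<open>\<nat>\<close> realises this.
\<close>

definition code :: "('v, 'e) pre_digraph \<Rightarrow> 'v \<Rightarrow> 'e \<times> nat \<Rightarrow> nat" where
  "code G v = to_nat_on (out_arcs G v \<times> UNIV)"

definition decode :: "('v, 'e) pre_digraph \<Rightarrow> 'v \<Rightarrow> nat \<Rightarrow> 'e \<times> nat" where
  "decode G v = from_nat_into (out_arcs G v \<times> UNIV)"

lemma code_decode:
  assumes "finite (out_arcs G v)" "out_arcs G v \<noteq> {}"
  shows "fst (decode G v n) \<in> out_arcs G v" "code G v (decode G v n) = n"
    "e \<in> out_arcs G v \<Longrightarrow> decode G v (code G v (e, n)) = (e, n)"
proof -
  let ?A = "out_arcs G v \<times> (UNIV :: nat set)"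
  have A: "countable ?A" "infinite ?A" "?A \<noteq> {}"
    using assms by (auto simp: countable_finite finite_cartesian_product_iff)
  show "fst (decode G v n) \<in> out_arcs G v"
    using from_nat_into[OF A(3), of n] by (auto simp: decode_def)
  show "code G v (decode G v n) = n"
    using A by (simp add: code_def decode_def)
  show "e \<in> out_arcs G v \<Longrightarrow> decode G v (code G v (e, n)) = (e, n)"
    using A by (simp add: code_def decode_def)
qed

text \<open>
  A vertex projects onto its copy, an edge \<open>e\<close> moves functions on the copy at its range to its part
  of the copy at its source, and \<open>e\<^sup>*\<close> moves them back.
\<close>

fun act :: "('v, 'e) pre_digraph \<Rightarrow> ('v, 'e) generator \<Rightarrow> ('v \<times> nat \<Rightarrow> 'f::field) \<Rightarrow> 'v \<times> nat \<Rightarrow> 'f"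
  where
    "act G (Vertex v) g x = (if fst x = v then g x else 0)"
  | "act G (Edge e) g x = (if fst x = tail G e \<and> fst (decode G (fst x) (snd x)) = e
       then g (head G e, snd (decode G (fst x) (snd x))) else 0)"
  | "act G (Ghost e) g x = (if fst x = head G e then g (tail G e, code G (tail G e) (e, snd x)) else 0)"

definition action :: "('v, 'e) pre_digraph \<Rightarrow> (('v, 'e) generator, 'f::field) free_algebra \<Rightarrow>
    ('v \<times> nat \<Rightarrow> 'f) \<Rightarrow> 'v \<times> nat \<Rightarrow> 'f" where
  "action G a g x = (\<Sum>w\<in>Poly_Mapping.keys a. Poly_Mapping.lookup a w * foldr (act G) (letters w) g x)"

lemma foldr_act_linear:
  "foldr (act G) ws (\<lambda>x. g x + h x) = (\<lambda>x. foldr (act G) ws g x + foldr (act G) ws h x)"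
  "foldr (act G) ws (\<lambda>x. c * g x) = (\<lambda>x. c * foldr (act G) ws g x)"
proof -
  have act: "act G t (\<lambda>x. g x + h x) = (\<lambda>x. act G t g x + act G t h x)"
    "act G t (\<lambda>x. c * g x) = (\<lambda>x. c * act G t g x)" for t g h
    by (cases t; auto)+
  show "foldr (act G) ws (\<lambda>x. g x + h x) = (\<lambda>x. foldr (act G) ws g x + foldr (act G) ws h x)"
    "foldr (act G) ws (\<lambda>x. c * g x) = (\<lambda>x. c * foldr (act G) ws g x)"
    by (induction ws) (simp_all add: act)
qed

lemma action_superset:
  assumes "finite T" "Poly_Mapping.keys a \<subseteq> T"
  shows "action G a g x = (\<Sum>w\<in>T. Poly_Mapping.lookup a w * foldr (act G) (letters w) g x)"
  unfolding action_def using assms by (intro sum.mono_neutral_left) (auto simp: in_keys_iff)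

lemma action_single: "action G (Poly_Mapping.single w c) g x = c * foldr (act G) (letters w) g x"
  using action_superset[of "{w}" "Poly_Mapping.single w c"] by simp

lemma action_monomial: "action G (monomial ws) g x = foldr (act G) ws g x"
  by (simp add: monomial_def action_single)

lemma action_zero: "action G 0 g x = 0"
  by (simp add: action_def)

lemma action_add: "action G (a + b) g x = action G a g x + action G b g x"
proof -
  let ?T = "Poly_Mapping.keys a \<union> Poly_Mapping.keys b"
  have "Poly_Mapping.keys (a + b) \<subseteq> ?T" by (rule Poly_Mapping.keys_add)
  then show ?thesis
    by (simp add: action_superset[of ?T] lookup_add distrib_right sum.distrib)
qed

lemma action_diff: "action G (a - b) g x = action G a g x - action G b g x"
  using action_add[of G "a - b" b g x] by simp

lemma action_sum: "action G (sum f I) g x = (\<Sum>i\<in>I. action G (f i) g x)"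
  by (induction I rule: infinite_finite_induct) (simp_all add: action_add action_zero)

lemma action_linear:
  "action G a (\<lambda>x. g x + h x) x = action G a g x + action G a h x"
  "action G a (\<lambda>x. c * g x) x = c * action G a g x"
  by (simp_all add: action_def foldr_act_linear distrib_left sum.distrib sum_distrib_left mult.left_commute)

lemma action_mult: "action G (a * b) g x = action G a (action G b g) x"
proof (induction a arbitrary: x rule: free_algebra_induct)
  case (single v c)
  show ?case
  proof (induction b rule: free_algebra_induct)
    case (single w d)
    have "action G (Poly_Mapping.single w d) g = (\<lambda>x. d * foldr (act G) (letters w) g x)"
      by (simp add: action_single fun_eq_iff)
    then show ?case
      by (simp add: mult_single action_single foldr_act_linear plus_free_monoid_def)
  next
    case (add b b')
    have "action G (b + b') g = (\<lambda>x. action G b g x + action G b' g x)"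
      by (simp add: action_add fun_eq_iff)
    then show ?case
      using add by (simp add: distrib_left action_add action_linear)
  qed
qed (simp add: distrib_right action_add)

lemma action_const_zero: "action G a (\<lambda>_. 0) x = 0"
  using action_linear(2)[of G a 0 "\<lambda>_. 0" x] by simp

text \<open>
  The last relation is the partition of the copy at \<open>v\<close> into parts indexed by the edges leaving \<open>v\<close>,
  and \<open>e\<^sup>* f = \<delta>\<close> holds because the parts are disjoint and \<open>code\<close> is injective.
\<close>

lemma action_relation:
  assumes "wf_digraph G" "row_finite G" "r \<in> leavitt_relations G"
  shows "action G r g x = 0"
proof -
  interpret wf_digraph G by fact
  have fin: "finite (out_arcs G v)" if "v \<in> verts G" for v
    using that assms(2) by (simp add: row_finite_def)
  have ne: "out_arcs G (tail G e) \<noteq> {}" "finite (out_arcs G (tail G e))" if "e \<in> arcs G" for e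
    using that fin[of "tail G e"] by auto
  have dec: "decode G (tail G e) (code G (tail G e) (e, n)) = (e, n)" if "e \<in> arcs G" for e n
    using code_decode(3)[OF ne(2,1)[OF that]] that by simp
  have enc: "code G (tail G e) (e, snd (decode G (tail G e) n)) = n"
    if "e \<in> arcs G" "fst (decode G (tail G e) n) = e" for e n
    using code_decode(2)[OF ne(2,1)[OF that(1)], of n] that(2) by (metis prod.collapse)
  have vsum: "action G (monomial [Vertex v] - (\<Sum>e\<in>out_arcs G v. monomial [Edge e, Ghost e])) g x = 0"
    if v: "v \<in> verts G" "out_arcs G v \<noteq> {}" for v
  proof (cases "fst x = v")
    case True
    let ?f = "fst (decode G v (snd x))"
    have f: "?f \<in> out_arcs G v"
      using code_decode(1)[OF fin[OF v(1)] v(2)] .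
    have "(\<Sum>e\<in>out_arcs G v. act G (Edge e) (act G (Ghost e) g) x) =
        (\<Sum>e\<in>out_arcs G v. if e = ?f then g x else 0)"
    proof (intro sum.cong refl)
      fix e assume e: "e \<in> out_arcs G v"
      then have "code G v (e, snd (decode G v (snd x))) = snd x" if "?f = e"
        using enc[of e "snd x"] that by auto
      then show "act G (Edge e) (act G (Ghost e) g) x = (if e = ?f then g x else 0)"
        using True e by (cases x) (auto simp del: prod.collapse)
    qed
    then show ?thesis
      using True f fin[OF v(1)] by (simp add: action_diff action_sum action_monomial)
  next
    case False
    then have "act G (Edge e) (act G (Ghost e) g) x = 0" if "e \<in> out_arcs G v" for e
      using that by auto
    then show ?thesis
      using False by (simp add: action_diff action_sum action_monomial)
  qed
  obtain u n where x: "x = (u, n)" by fastforce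
  show ?thesis
    using assms(3) unfolding leavitt_relations_def
  proof (elim UnE CollectE exE conjE)
    fix v assume "r = monomial [Vertex v] - (\<Sum>e\<in>out_arcs G v. monomial [Edge e, Ghost e])"
      "v \<in> verts G" "out_arcs G v \<noteq> {}"
    then show ?thesis using vsum by simp
  qed (auto simp: x action_diff action_monomial action_zero dec)
qed

lemma action_ideal:
  assumes "wf_digraph G" "row_finite G" "a \<in> ideal_generated (generators G) (leavitt_relations G)"
  shows "action G a g x = 0"
  using assms(3)
proof (induction arbitrary: g x)
  case (incl r)
  then show ?case using action_relation assms by blast
next
  case (smult a c)
  then have "action G a g = (\<lambda>_. 0)" by (simp add: fun_eq_iff)
  then show ?case by (simp add: action_mult action_const_zero)
next
  case (lmult a y)
  then have "action G a g = (\<lambda>_. 0)" by (simp add: fun_eq_iff)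
  then show ?case by (simp add: action_mult action_const_zero)
qed (simp_all add: action_zero action_add action_mult)

text \<open>
  The vertex \<open>v\<close> acts as a nonzero projection, since its copy of \<open>\<nat>\<close> is not empty.
\<close>

lemma vertex_not_in_ideal:
  fixes G :: "('v, 'e) pre_digraph"
  assumes "wf_digraph G" "row_finite G"
  shows "monomial [Vertex v] \<notin>
    (ideal_generated (generators G) (leavitt_relations G) :: (('v, 'e) generator, 'f::field) free_algebra set)"
proof
  assume "monomial [Vertex v] \<in>
    (ideal_generated (generators G) (leavitt_relations G) :: (('v, 'e) generator, 'f) free_algebra set)"
  from action_ideal[OF assms this, of "\<lambda>_. 1" "(v, 0)"] show False
    by (simp add: action_monomial)
qed

section \<open>Cycles and long walks\<close>

context wf_digraph begin

lemma cycle_iff: "cycle C \<longleftrightarrow> (\<exists>u. awalk u C u) \<and> C \<noteq> [] \<and> distinct (map (tail G) C)"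
  by (rule cycle_iff_distinct_sources)

lemma awalk_split_at:
  assumes "awalk u p w" "e \<in> set p"
  obtains p1 p2 where "p = p1 @ e # p2" "awalk u p1 (tail G e)" "awalk (tail G e) (e # p2) w"
proof -
  obtain p1 p2 where p: "p = p1 @ e # p2"
    using assms(2) by (meson split_list)
  then have "awalk u p1 (tail G e)" "awalk (tail G e) (e # p2) w"
    using assms(1) by (auto simp: awalk_Cons_iff)
  with p show ?thesis using that by blast
qed

lemma walk_from_arc: "awalk u p w \<Longrightarrow> e \<in> set p \<Longrightarrow> \<exists>q. awalk (tail G e) q w"
  using awalk_split_at by metis

lemma rotate_cycle:
  assumes "cycle C" "v \<in> cycle_verts G C"
  obtains D where "awalk v D v" "cycle D" "set D = set C"
proof -
  obtain e where e: "e \<in> set C" "v = tail G e"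
    using assms(2) by (auto simp: cycle_verts_def)
  obtain u where u: "awalk u C u" "distinct (map (tail G) C)"
    using assms(1) by (auto simp: cycle_iff)
  obtain p1 p2 where p: "C = p1 @ e # p2" "awalk u p1 v" "awalk v (e # p2) u"
    using awalk_split_at[OF u(1) e(1)] e(2) by blast
  have "awalk v (e # p2 @ p1) v"
    using awalk_appendI[OF p(3,2)] by simp
  moreover from this have "cycle (e # p2 @ p1)"
    unfolding cycle_iff using u(2) p(1) by auto
  ultimately show ?thesis
    using that[of "e # p2 @ p1"] p(1) by auto
qed

lemma cycle_connected:
  assumes "cycle C" "v \<in> cycle_verts G C" "w \<in> cycle_verts G C"
  obtains p where "awalk v p w"
proof -
  obtain D where D: "awalk v D v" "set D = set C"
    using rotate_cycle[OF assms(1,2)] by metis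
  obtain e where "e \<in> set D" "w = tail G e"
    using assms(3) D(2) by (auto simp: cycle_verts_def)
  then show ?thesis
    using awalk_split_at[OF D(1)] that by metis
qed

lemma head_in_cycle_verts:
  assumes "cycle C" "e \<in> set C"
  shows "head G e \<in> cycle_verts G C"
proof -
  obtain D where D: "awalk (tail G e) D (tail G e)" "set D = set C"
    using rotate_cycle[OF assms(1), of "tail G e"] assms(2) by (auto simp: cycle_verts_def)
  obtain p1 p2 where p: "D = p1 @ e # p2" "awalk (tail G e) (e # p2) (tail G e)"
    using awalk_split_at[OF D(1), of e] assms(2) D(2) by metis
  show ?thesis
  proof (cases p2)
    case Nil
    then have "head G e = tail G e" using p(2) by (simp add: awalk_simps)
    then show ?thesis using assms(2) by (simp add: cycle_verts_def)
  next
    case (Cons f q)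
    then have "head G e = tail G f" "f \<in> set C"
      using p D(2) by (auto simp: awalk_simps)
    then show ?thesis by (simp add: cycle_verts_def)
  qed
qed

lemma cycle_verts_subset: "cycle C \<Longrightarrow> cycle_verts G C \<subseteq> verts G"
  unfolding cycle_iff cycle_verts_def awalk_def using wellformed(1) by blast

lemma hereditary_NE_cycle:
  assumes "NE_cycle G C"
  shows "hereditary G (cycle_verts G C)"
proof -
  have C: "cycle C" and ne: "\<And>e. e \<in> arcs G \<Longrightarrow> tail G e \<in> cycle_verts G C \<Longrightarrow> e \<in> set C"
    using assms by (auto simp: NE_cycle_def)
  have "w \<in> cycle_verts G C" if "awalk u p w" "u \<in> cycle_verts G C" for u p w
    using that
  proof (induction p arbitrary: u)
    case (Cons e p)
    then show ?case
      using head_in_cycle_verts[OF C, of e] ne[of e] by (auto simp: awalk_simps)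
  qed (auto simp: awalk_simps)
  then show ?thesis
    using cycle_verts_subset[OF C] by (auto simp: hereditary_def)
qed

text \<open>
  A repeated source bounds a closed subwalk; a shortest one repeats no source.
\<close>

lemma cycle_in_walk:
  assumes "awalk u p w" "\<not> distinct (map (tail G) p)"
  obtains C where "cycle C" "set C \<subseteq> set p"
proof -
  have "\<exists>C. cycle C \<and> set C \<subseteq> set p"
    using assms
  proof (induction "length p" arbitrary: u p w rule: less_induct)
    case less
    obtain xs ys zs y where "map (tail G) p = xs @ [y] @ ys @ [y] @ zs"
      using not_distinct_decomp[OF less.prems(2)] by blast
    then obtain p1 e p2 f p3 where p: "p = p1 @ e # p2 @ f # p3" "tail G e = y" "tail G f = y"
      by (auto simp: map_eq_append_conv map_eq_Cons_conv append_eq_map_conv Cons_eq_map_conv)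
    then have C: "awalk y (e # p2) y"
      using less.prems(1) by (auto simp: awalk_Cons_iff)
    show ?case
    proof (cases "distinct (map (tail G) (e # p2))")
      case True
      then have "cycle (e # p2)" using C unfolding cycle_iff by blast
      then show ?thesis using p(1) by (intro exI[of _ "e # p2"]) auto
    next
      case False
      then have "\<exists>D. cycle D \<and> set D \<subseteq> set (e # p2)"
        using less.hyps[OF _ C] p(1) by auto
      then show ?thesis using p(1) by auto
    qed
  qed
  then show ?thesis using that by blast
qed

lemma cycle_in_long_walk:
  assumes "awalk u p w" "finite T" "tail G ` set p \<subseteq> T" "card T < length p"
  obtains C where "cycle C" "set C \<subseteq> set p"
proof -
  have "card (set (map (tail G) p)) \<le> card T"
    using assms(2,3) by (intro card_mono) auto
  then have "\<not> distinct (map (tail G) p)"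
    using assms(4) distinct_card[of "map (tail G) p"] by fastforce
  then show ?thesis using cycle_in_walk[OF assms(1)] that by blast
qed

text \<open>
  If every vertex of \<open>T\<close> has an edge into \<open>T\<close>, walks inside \<open>T\<close> can be prolonged until they exceed
  the size of \<open>T\<close>.
\<close>

lemma sink_or_cycle:
  assumes "finite T" "T \<noteq> {}" "T \<subseteq> verts G"
  obtains v where "v \<in> T" "\<And>e. e \<in> arcs G \<Longrightarrow> tail G e = v \<Longrightarrow> head G e \<notin> T"
    | C where "cycle C" "cycle_verts G C \<subseteq> T"
proof (cases "\<exists>v\<in>T. \<forall>e\<in>arcs G. tail G e = v \<longrightarrow> head G e \<notin> T")
  case False
  then have step: "\<exists>e\<in>arcs G. tail G e = v \<and> head G e \<in> T" if "v \<in> T" for v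
    using that by blast
  have walks: "\<exists>p w. awalk v p w \<and> length p = n \<and> tail G ` set p \<subseteq> T" if "v \<in> T" for n v
    using that
  proof (induction n arbitrary: v)
    case 0
    then have "awalk v [] v" using assms(3) by (auto simp: awalk_simps)
    then show ?case by fastforce
  next
    case (Suc n)
    obtain e where e: "e \<in> arcs G" "tail G e = v" "head G e \<in> T"
      using step[OF Suc.prems] by blast
    obtain p w where p: "awalk (head G e) p w" "length p = n" "tail G ` set p \<subseteq> T"
      using Suc.IH[OF e(3)] by blast
    have "awalk v (e # p) w"
      using e p by (simp add: awalk_simps)
    then show ?case
      using e p Suc.prems by (intro exI[of _ "e # p"] exI[of _ w]) auto
  qed
  obtain v where "v \<in> T" using assms(2) by blast
  then obtain p w where p: "awalk v p w" "length p = Suc (card T)" "tail G ` set p \<subseteq> T"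
    using walks by blast
  obtain C where "cycle C" "set C \<subseteq> set p"
    using cycle_in_long_walk[OF p(1) assms(1) p(3)] p(2) by auto
  then have "cycle_verts G C \<subseteq> T"
    using p(3) by (auto simp: cycle_verts_def)
  then show ?thesis using that(2) \<open>cycle C\<close> by blast
qed (use that in blast)

end

definition cycle_power :: "'e list \<Rightarrow> nat \<Rightarrow> 'e list" where
  "cycle_power C n = concat (replicate n C)"

lemma cycle_power_simps [simp]:
  "cycle_power C 0 = []" "cycle_power C (Suc n) = C @ cycle_power C n"
  by (simp_all add: cycle_power_def)

lemma length_cycle_power: "length (cycle_power C n) = n * length C"
  by (induction n) simp_all

lemma cycle_power_add: "cycle_power C (m + n) = cycle_power C m @ cycle_power C n"
  by (induction m) simp_all

lemma (in wf_digraph) awalk_cycle_power: "awalk v C v \<Longrightarrow> awalk v (cycle_power C n) v"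
  by (induction n) (auto intro: awalk_appendI simp: awalk_simps simp del: awalk_append_iff)

text \<open>
  The source \<open>v\<close> occurs in \<open>C\<close> only at the start, so a suffix of a power of \<open>C\<close> that starts at \<open>v\<close>
  starts at the beginning of one of the copies of \<open>C\<close>.
\<close>

lemma (in wf_digraph) suffix_cycle_power:
  assumes "awalk v C v" "distinct (map (tail G) C)" "cycle_power C m = d @ c" "awalk v c w"
  shows "\<exists>i. c = cycle_power C i"
  using assms(3)
proof (induction m arbitrary: d)
  case 0
  then show ?case by (intro exI[of _ 0]) simp
next
  case (Suc m)
  then have eq: "C @ cycle_power C m = d @ c" by simp
  then consider d' where "d = C @ d'" "cycle_power C m = d' @ c"
    | c' where "C = d @ c'" "c = c' @ cycle_power C m" "c' \<noteq> []"
    unfolding append_eq_append_conv2 by (metis append_Nil append_Nil2)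
  then show ?case
  proof cases
    case 1
    then show ?thesis using Suc.IH by blast
  next
    case (2 c')
    show ?thesis
    proof (cases d)
      case Nil
      then have "c = cycle_power C (Suc m)" using eq by simp
      then show ?thesis by blast
    next
      case (Cons e d')
      obtain f c'' where "c' = f # c''" using 2(3) by (cases c') auto
      then have "tail G e = v" "tail G f = v"
        using assms(1,4) 2 Cons by (auto simp: awalk_Cons_iff)
      then show ?thesis
        using assms(2) 2(1) Cons \<open>c' = f # c''\<close> by auto
    qed
  qed
qed

section \<open>Families satisfying the Leavitt relations\<close>

text \<open>
  A ring with scalars as a module record, so that spans and generated subalgebras of the record-based
  and of the type-based setting are instances of the same definitions.
\<close>

definition ring_module :: "('f \<Rightarrow> 'r::ring_1) \<Rightarrow> ('f, 'r) module" where
  "ring_module K = \<lparr>carrier = UNIV, monoid.mult = (*), one = 1, zero = 0, add = (+),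
     smult = (\<lambda>c x. K c * x)\<rparr>"

lemma ring_module_simps [simp]:
  "x \<otimes>\<^bsub>ring_module K\<^esub> y = x * y" "x \<oplus>\<^bsub>ring_module K\<^esub> y = x + y"
  "\<zero>\<^bsub>ring_module K\<^esub> = 0" "c \<odot>\<^bsub>ring_module K\<^esub> x = K c * x"
  "carrier (ring_module K) = UNIV"
  by (simp_all add: ring_module_def)

lemma linear_span_mono: "T \<subseteq> T' \<Longrightarrow> linear_span A T \<subseteq> linear_span A T'"
proof
  fix x assume "T \<subseteq> T'" "x \<in> linear_span A T"
  from this(2,1) show "x \<in> linear_span A T'"
    by induction (auto intro: linear_span.intros)
qed

lemma linear_span_minimal:
  assumes "S \<subseteq> linear_span A T"
  shows "linear_span A S \<subseteq> linear_span A T"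
proof
  fix x assume "x \<in> linear_span A S"
  then show "x \<in> linear_span A T"
    by induction (use assms in \<open>auto intro: linear_span.intros\<close>)
qed

text \<open>
  Elements of a ring that satisfy the relations of the Leavitt path algebra.  Scalars are a central
  copy of the field, vertices are \<open>P\<close>, edges are \<open>E\<close>, and \<open>S\<close> are the ghost edges \<open>e\<^sup>*\<close>.  The
  nonvanishing of the vertices is the only consequence of freeness that the description of the center
  rests on.
\<close>

locale leavitt_family = wf_digraph G
  for G :: "('v, 'e) pre_digraph" +
  fixes K :: "'f::field \<Rightarrow> 'r::ring_1" and P :: "'v \<Rightarrow> 'r" and E S :: "'e \<Rightarrow> 'r"
  assumes K_add: "K (a + b) = K a + K b"
    and K_mult: "K (a * b) = K a * K b"
    and K_one: "K 1 = 1"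
    and K_central: "x * K a = K a * x"
    and vertex_mult: "\<lbrakk>v \<in> verts G; w \<in> verts G\<rbrakk> \<Longrightarrow> P v * P w = (if v = w then P v else 0)"
    and tail_edge: "e \<in> arcs G \<Longrightarrow> P (tail G e) * E e = E e"
    and edge_head: "e \<in> arcs G \<Longrightarrow> E e * P (head G e) = E e"
    and head_ghost: "e \<in> arcs G \<Longrightarrow> P (head G e) * S e = S e"
    and ghost_tail: "e \<in> arcs G \<Longrightarrow> S e * P (tail G e) = S e"
    and ghost_edge: "\<lbrakk>e \<in> arcs G; f \<in> arcs G\<rbrakk> \<Longrightarrow> S e * E f = (if e = f then P (head G e) else 0)"
    and vertex_sum: "\<lbrakk>v \<in> verts G; out_arcs G v \<noteq> {}\<rbrakk> \<Longrightarrow> P v = (\<Sum>e\<in>out_arcs G v. E e * S e)"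
    and vertex_nonzero: "v \<in> verts G \<Longrightarrow> P v \<noteq> 0"
    and out_arcs_finite: "v \<in> verts G \<Longrightarrow> finite (out_arcs G v)"
begin

abbreviation A :: "('f, 'r) module" where "A \<equiv> ring_module K"

lemma K_zero: "K 0 = 0"
  using K_add[of 0 0] by simp

lemma K_eq_zero: "K a * x = 0 \<longleftrightarrow> a = 0 \<or> x = 0"
proof (cases "a = 0")
  case False
  have "x = K (inverse a) * (K a * x)"
    using False by (simp add: K_one flip: mult.assoc K_mult)
  then show ?thesis using False by auto
qed (simp add: K_zero)

lemma K_uminus: "K (- a) = - K a"
  using K_add[of a "- a"] by (simp add: K_zero eq_neg_iff_add_eq_0 add.commute)

lemma K_assoc: "x * (K a * y) = K a * (x * y)"
  by (metis K_central mult.assoc)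

lemma K_uminus_one: "K (- 1) * x = - x"
  by (simp add: K_uminus K_one)

lemma span_add: "x \<in> linear_span A T \<Longrightarrow> y \<in> linear_span A T \<Longrightarrow> x + y \<in> linear_span A T"
  using linear_span.add[of x A T y] by simp

lemma span_smult: "x \<in> linear_span A T \<Longrightarrow> K c * x \<in> linear_span A T"
  using linear_span.smult[of x A T c] by simp

lemma span_zero: "0 \<in> linear_span A T"
  using linear_span.zero[of A T] by simp

lemma span_sum: "(\<And>i. i \<in> I \<Longrightarrow> f i \<in> linear_span A T) \<Longrightarrow> sum f I \<in> linear_span A T"
  by (induction I rule: infinite_finite_induct) (auto intro: span_add span_zero)

lemma span_induct [consumes 1, case_names zero incl add smult]:
  assumes "x \<in> linear_span A T" "Q 0" "\<And>x. x \<in> T \<Longrightarrow> Q x"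
    "\<And>x y. Q x \<Longrightarrow> Q y \<Longrightarrow> Q (x + y)" "\<And>c x. Q x \<Longrightarrow> Q (K c * x)"
  shows "Q x"
  using assms(1) by induction (auto intro: assms)

text \<open>
  For a hereditary set \<open>W\<close>, \<open>sub W\<close> is the algebra \<open>L(W)\<close> of the graph restricted to \<open>W\<close>.
\<close>

definition gens :: "'v set \<Rightarrow> 'r set" where
  "gens W = P ` W \<union> (\<Union>e\<in>{e \<in> arcs G. tail G e \<in> W \<and> head G e \<in> W}. {E e, S e})"

definition sub :: "'v set \<Rightarrow> 'r set" where
  "sub W = subalgebra_generated A (gens W)"

abbreviation L :: "'r set" where "L \<equiv> sub (verts G)"

lemma sub_zero: "0 \<in> sub W"
  and sub_add: "x \<in> sub W \<Longrightarrow> y \<in> sub W \<Longrightarrow> x + y \<in> sub W"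
  and sub_smult: "x \<in> sub W \<Longrightarrow> K c * x \<in> sub W"
  and sub_mult: "x \<in> sub W \<Longrightarrow> y \<in> sub W \<Longrightarrow> x * y \<in> sub W"
  unfolding sub_def
  using subalgebra_generated.zero[of A "gens W"] subalgebra_generated.add[of x A "gens W" y]
     subalgebra_generated.smult[of x A "gens W" c] subalgebra_generated.mult[of x A "gens W" y]
  by simp_all

lemma sub_uminus: "x \<in> sub W \<Longrightarrow> - x \<in> sub W"
  using sub_smult[of x W "- 1"] by (simp add: K_uminus_one)

lemma sub_diff: "x \<in> sub W \<Longrightarrow> y \<in> sub W \<Longrightarrow> x - y \<in> sub W"
  using sub_add[OF _ sub_uminus, of x W y] by simp

lemma sub_sum: "(\<And>i. i \<in> I \<Longrightarrow> f i \<in> sub W) \<Longrightarrow> sum f I \<in> sub W"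
  by (induction I rule: infinite_finite_induct) (auto intro: sub_add sub_zero)

lemma sub_vertex: "v \<in> W \<Longrightarrow> P v \<in> sub W"
  and sub_edge: "\<lbrakk>e \<in> arcs G; tail G e \<in> W; head G e \<in> W\<rbrakk> \<Longrightarrow> E e \<in> sub W"
  and sub_ghost: "\<lbrakk>e \<in> arcs G; tail G e \<in> W; head G e \<in> W\<rbrakk> \<Longrightarrow> S e \<in> sub W"
  unfolding sub_def gens_def by (blast intro: subalgebra_generated.incl)+

lemma sub_induct [consumes 1, case_names zero vertex edge ghost add smult mult]:
  assumes "x \<in> sub W" "Q 0" "\<And>v. v \<in> W \<Longrightarrow> Q (P v)"
    "\<And>e. \<lbrakk>e \<in> arcs G; tail G e \<in> W; head G e \<in> W\<rbrakk> \<Longrightarrow> Q (E e)"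
    "\<And>e. \<lbrakk>e \<in> arcs G; tail G e \<in> W; head G e \<in> W\<rbrakk> \<Longrightarrow> Q (S e)"
    "\<And>x y. \<lbrakk>x \<in> sub W; y \<in> sub W; Q x; Q y\<rbrakk> \<Longrightarrow> Q (x + y)"
    "\<And>c x. \<lbrakk>x \<in> sub W; Q x\<rbrakk> \<Longrightarrow> Q (K c * x)"
    "\<And>x y. \<lbrakk>x \<in> sub W; y \<in> sub W; Q x; Q y\<rbrakk> \<Longrightarrow> Q (x * y)"
  shows "Q x"
  using assms(1) unfolding sub_def
proof induction
  case (incl x)
  then show ?case using assms(3-5) by (auto simp: gens_def)
qed (use assms in \<open>auto simp: sub_def\<close>)

lemma sub_mono: "W \<subseteq> W' \<Longrightarrow> sub W \<subseteq> sub W'"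
proof
  fix x assume "W \<subseteq> W'" "x \<in> sub W"
  from this(2,1) show "x \<in> sub W'"
    by (induction rule: sub_induct)
      (auto intro: sub_zero sub_add sub_smult sub_mult sub_vertex sub_edge sub_ghost)
qed

lemma commute_sub:
  assumes "x \<in> sub W" "\<And>v. v \<in> W \<Longrightarrow> z * P v = P v * z"
    "\<And>e. \<lbrakk>e \<in> arcs G; tail G e \<in> W; head G e \<in> W\<rbrakk> \<Longrightarrow> z * E e = E e * z"
    "\<And>e. \<lbrakk>e \<in> arcs G; tail G e \<in> W; head G e \<in> W\<rbrakk> \<Longrightarrow> z * S e = S e * z"
  shows "z * x = x * z"
  using assms(1)
proof (induction rule: sub_induct)
  case (mult x y)
  then show ?case by (metis mult.assoc)
qed (simp_all add: assms algebra_simps K_assoc)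

section \<open>Paths\<close>

text \<open>
  The elements \<open>p\<close> and \<open>p\<^sup>*\<close> of a path \<open>p\<close>.  Both carry the vertex at the range of the path as a
  factor; this makes the path of length \<open>0\<close> the base case and changes nothing else, as \<open>e r(e) = e\<close>.
\<close>

primrec epath :: "'v \<Rightarrow> 'e list \<Rightarrow> 'r" where
  "epath u [] = P u"
| "epath u (e # p) = E e * epath (head G e) p"

primrec gpath :: "'v \<Rightarrow> 'e list \<Rightarrow> 'r" where
  "gpath u [] = P u"
| "gpath u (e # p) = gpath (head G e) p * S e"

lemma vertex_idem: "v \<in> verts G \<Longrightarrow> P v * P v = P v"
  by (simp add: vertex_mult)

lemma tail_edge': "e \<in> arcs G \<Longrightarrow> P (tail G e) * (E e * x) = E e * x"
  and edge_head': "e \<in> arcs G \<Longrightarrow> E e * (P (head G e) * x) = E e * x"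
  and head_ghost': "e \<in> arcs G \<Longrightarrow> P (head G e) * (S e * x) = S e * x"
  and ghost_tail': "e \<in> arcs G \<Longrightarrow> S e * (P (tail G e) * x) = S e * x"
  and ghost_edge': "\<lbrakk>e \<in> arcs G; f \<in> arcs G\<rbrakk> \<Longrightarrow>
    S e * (E f * x) = (if e = f then P (head G e) * x else 0)"
  and vertex_idem': "v \<in> verts G \<Longrightarrow> P v * (P v * x) = P v * x"
  by (simp_all add: tail_edge edge_head head_ghost ghost_tail ghost_edge vertex_idem flip: mult.assoc)

lemma epath_source: "awalk u p w \<Longrightarrow> P u * epath u p = epath u p"
  by (cases p) (auto simp: awalk_simps vertex_idem tail_edge')

lemma gpath_source: "awalk u p w \<Longrightarrow> gpath u p * P u = gpath u p"
  by (cases p) (auto simp: awalk_simps vertex_idem ghost_tail mult.assoc)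

lemma epath_target: "awalk u p w \<Longrightarrow> epath u p * P w = epath u p"
  by (induction p arbitrary: u) (auto simp: awalk_simps vertex_idem mult.assoc)

lemma gpath_target: "awalk u p w \<Longrightarrow> P w * gpath u p = gpath u p"
  by (induction p arbitrary: u) (auto simp: awalk_simps vertex_idem simp flip: mult.assoc)

lemma epath_append: "awalk u p w \<Longrightarrow> awalk w q x \<Longrightarrow> epath u (p @ q) = epath u p * epath w q"
  by (induction p arbitrary: u) (auto simp: awalk_simps epath_source mult.assoc)

lemma gpath_append: "awalk u p w \<Longrightarrow> awalk w q x \<Longrightarrow> gpath u (p @ q) = gpath w q * gpath u p"
  by (induction p arbitrary: u) (auto simp: awalk_simps gpath_source mult.assoc)

lemma gpath_epath_same: "awalk u p w \<Longrightarrow> gpath u p * epath u p = P w"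
proof (induction p arbitrary: u)
  case (Cons e p)
  then show ?case
    using epath_source[of "head G e" p w]
    by (simp add: awalk_simps mult.assoc ghost_edge')
qed (auto simp: awalk_simps vertex_idem)

lemma gpath_epath_shorter:
  assumes "awalk u p w" "awalk w q x"
  shows "gpath u p * epath u (p @ q) = epath w q" "gpath u (p @ q) * epath u p = gpath w q"
proof -
  show "gpath u p * epath u (p @ q) = epath w q"
    using epath_append[OF assms] gpath_epath_same[OF assms(1)] epath_source[OF assms(2)]
    by (simp flip: mult.assoc)
  show "gpath u (p @ q) * epath u p = gpath w q"
    using gpath_append[OF assms] gpath_epath_same[OF assms(1)] gpath_source[OF assms(2)]
    by (simp add: mult.assoc)
qed

text \<open>
  Cancelling edges from \<open>p\<^sup>* q\<close> with \<open>e\<^sup>* f = \<delta>\<close> either meets two different edges or uses up one of the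
  paths.
\<close>

lemma gpath_epath_cases:
  assumes "awalk u p w" "awalk u q x"
  obtains "gpath u p * epath u q = 0"
    | r where "q = p @ r" "awalk w r x" "gpath u p * epath u q = epath w r"
    | r where "p = q @ r" "awalk x r w" "gpath u p * epath u q = gpath x r"
proof -
  have "gpath u p * epath u q = 0 \<or> (\<exists>r. q = p @ r) \<or> (\<exists>r. p = q @ r)"
    using assms
  proof (induction p arbitrary: u q)
    case (Cons e p)
    show ?case
    proof (cases q)
      case Nil
      then show ?thesis by simp
    next
      case (Cons f q')
      show ?thesis
      proof (cases "e = f")
        case True
        then have "gpath u (e # p) * epath u q = gpath (head G e) p * epath (head G e) q'"
          using Cons Cons.prems epath_source[of "head G e" q' x]
          by (simp add: awalk_simps mult.assoc ghost_edge')
        then show ?thesis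
          using Cons.IH[of "head G e" q'] Cons.prems Cons True by (auto simp: awalk_simps)
      next
        case False
        then show ?thesis
          using Cons Cons.prems by (simp add: awalk_simps mult.assoc ghost_edge')
      qed
    qed
  qed simp
  then consider "gpath u p * epath u q = 0" | r where "q = p @ r" | r where "p = q @ r"
    by blast
  then show ?thesis
  proof cases
    case (2 r)
    then have r: "awalk w r x" using assms awlast_of_awalk by auto
    show ?thesis
      using that(2)[OF 2 r] gpath_epath_shorter(1)[OF assms(1) r] 2 by simp
  next
    case (3 r)
    then have r: "awalk x r w" using assms awlast_of_awalk by auto
    show ?thesis
      using that(3)[OF 3 r] gpath_epath_shorter(2)[OF assms(2) r] 3 by simp
  qed (rule that(1))
qed

lemma awalk_in_hereditary:
  assumes "awalk u p w" "hereditary G W" "u \<in> W"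
  shows "w \<in> W"
  using assms unfolding hereditary_def by blast

lemma hereditary_head:
  assumes "hereditary G W" "e \<in> arcs G" "tail G e \<in> W"
  shows "head G e \<in> W"
  using awalk_in_hereditary[OF arc_implies_awalk[OF assms(2)] assms(1,3)] .

lemma path_in_sub:
  assumes "hereditary G W" "awalk u p w" "u \<in> W"
  shows "epath u p \<in> sub W \<and> gpath u p \<in> sub W"
  using assms(2,3)
proof (induction p arbitrary: u)
  case (Cons e p)
  then show ?case
    using hereditary_head[OF assms(1), of e]
    by (auto simp: awalk_simps intro!: sub_mult sub_edge sub_ghost)
qed (auto intro: sub_vertex)

lemma hereditary_verts: "hereditary G (verts G)"
  by (auto simp: hereditary_def)

lemma path_in_L: "awalk u p w \<Longrightarrow> epath u p \<in> L" "awalk u p w \<Longrightarrow> gpath u p \<in> L"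
  using path_in_sub[OF hereditary_verts, of u p w] by auto

section \<open>Local units and the spanning set of path products\<close>

lemma vertex_sum_mult:
  assumes "finite F" "F \<subseteq> verts G" "v \<in> verts G"
  shows "(\<Sum>v\<in>F. P v) * P v = (if v \<in> F then P v else 0)"
    "P v * (\<Sum>v\<in>F. P v) = (if v \<in> F then P v else 0)"
proof -
  have "(\<Sum>u\<in>F. P u) * P v = (\<Sum>u\<in>F. if u = v then P v else 0)"
    unfolding sum_distrib_right using assms by (intro sum.cong) (auto simp: vertex_mult)
  then show "(\<Sum>v\<in>F. P v) * P v = (if v \<in> F then P v else 0)"
    using assms by simp
  have "P v * (\<Sum>u\<in>F. P u) = (\<Sum>u\<in>F. if u = v then P v else 0)"
    unfolding sum_distrib_left using assms by (intro sum.cong) (auto simp: vertex_mult)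
  then show "P v * (\<Sum>v\<in>F. P v) = (if v \<in> F then P v else 0)"
    using assms by simp
qed

lemma local_unit:
  assumes "x \<in> L"
  obtains F where "finite F" "F \<subseteq> verts G" "(\<Sum>v\<in>F. P v) * x = x" "x * (\<Sum>v\<in>F. P v) = x"
proof -
  define U where "U F = (\<Sum>v\<in>F. P v)" for F
  have U: "U F * P v = P v" "P v * U F = P v" if "finite F" "F \<subseteq> verts G" "v \<in> F" for F v
    using vertex_sum_mult[of F v] that by (auto simp: U_def)
  have UU: "U F * U F' = U F'" "U F' * U F = U F'"
    if "finite F" "F \<subseteq> verts G" "F' \<subseteq> F" for F F'
    unfolding U_def[of F'] sum_distrib_left sum_distrib_right
    using that U by (auto intro!: sum.cong)
  have up: "U F * x = x \<and> x * U F = x"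
    if "U F' * x = x \<and> x * U F' = x" "finite F" "F \<subseteq> verts G" "F' \<subseteq> F" for F F' x
    using that UU by (metis mult.assoc)
  have "\<exists>F. finite F \<and> F \<subseteq> verts G \<and> U F * x = x \<and> x * U F = x"
    using assms
  proof (induction rule: sub_induct)
    case zero
    show ?case by (intro exI[of _ "{}"]) simp
  next
    case (vertex v)
    then show ?case by (intro exI[of _ "{v}"]) (simp add: U_def vertex_idem)
  next
    case (edge e)
    then have "U {tail G e} * E e = E e" "E e * U {head G e} = E e"
      by (simp_all add: U_def tail_edge edge_head)
    then have "U {tail G e, head G e} * E e = E e" "E e * U {tail G e, head G e} = E e"
      using edge UU[of "{tail G e, head G e}" "{tail G e}"] UU[of "{tail G e, head G e}" "{head G e}"]
      by (simp, metis mult.assoc)+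
    then show ?case
      using edge by (intro exI[of _ "{tail G e, head G e}"]) simp
  next
    case (ghost e)
    then have "S e * U {tail G e} = S e" "U {head G e} * S e = S e"
      by (simp_all add: U_def ghost_tail head_ghost)
    then have "U {tail G e, head G e} * S e = S e" "S e * U {tail G e, head G e} = S e"
      using ghost UU[of "{tail G e, head G e}" "{tail G e}"] UU[of "{tail G e, head G e}" "{head G e}"]
      by (simp, metis mult.assoc)+
    then show ?case
      using ghost by (intro exI[of _ "{tail G e, head G e}"]) simp
  next
    case (add x y)
    then obtain F F' where "finite F" "F \<subseteq> verts G" "U F * x = x \<and> x * U F = x"
      "finite F'" "F' \<subseteq> verts G" "U F' * y = y \<and> y * U F' = y" by blast
    then have "finite (F \<union> F')" "F \<union> F' \<subseteq> verts G"
       "U (F \<union> F') * x = x \<and> x * U (F \<union> F') = x" "U (F \<union> F') * y = y \<and> y * U (F \<union> F') = y"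
      using up[of F x "F \<union> F'"] up[of F' y "F \<union> F'"] by auto
    then show ?case by (metis distrib_left distrib_right)
  next
    case (smult c x)
    then show ?case by (metis K_assoc mult.assoc)
  next
    case (mult x y)
    then obtain F F' where "finite F" "F \<subseteq> verts G" "U F * x = x \<and> x * U F = x"
      "finite F'" "F' \<subseteq> verts G" "U F' * y = y \<and> y * U F' = y" by blast
    then have "finite (F \<union> F')" "F \<union> F' \<subseteq> verts G"
       "U (F \<union> F') * x = x \<and> x * U (F \<union> F') = x" "U (F \<union> F') * y = y \<and> y * U (F \<union> F') = y"
      using up[of F x "F \<union> F'"] up[of F' y "F \<union> F'"] by auto
    then show ?case by (metis mult.assoc)
  qed
  then show ?thesis using that by (auto simp: U_def)
qed

definition path_products :: "'r set" where
  "path_products = {epath u p * gpath u' q | u p u' q w. awalk u p w \<and> awalk u' q w}"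

text \<open>
  Left multiplication by an edge lengthens \<open>p\<close> in \<open>p q\<^sup>*\<close>; by a ghost edge it shortens \<open>p\<close>, or lengthens
  \<open>q\<close> once \<open>p\<close> is used up.
\<close>

lemma generator_mult_path_product:
  assumes "m \<in> path_products"
  shows "v \<in> verts G \<Longrightarrow> P v * m \<in> insert 0 path_products"
    and "e \<in> arcs G \<Longrightarrow> E e * m \<in> insert 0 path_products"
    and "e \<in> arcs G \<Longrightarrow> S e * m \<in> insert 0 path_products"
proof -
  obtain u p u' q w where m: "m = epath u p * gpath u' q" and p: "awalk u p w" and q: "awalk u' q w"
    using assms unfolding path_products_def by blast
  have u: "u \<in> verts G" using p by auto
  have source: "m = P u * m"
    using epath_source[OF p] by (simp add: m flip: mult.assoc)
  show vm: "P v * m \<in> insert 0 path_products" if "v \<in> verts G" for v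
    using source assms that u by (metis insertCI mult.assoc mult_zero_left vertex_mult)
  show "E e * m \<in> insert 0 path_products" if e: "e \<in> arcs G"
  proof (cases "head G e = u")
    case True
    then have "awalk (tail G e) (e # p) w"
      using p e by (simp add: awalk_simps)
    moreover have "E e * m = epath (tail G e) (e # p) * gpath u' q"
      using True by (simp add: m mult.assoc)
    ultimately show ?thesis using q unfolding path_products_def by blast
  next
    case False
    have "E e * m = E e * (P (head G e) * (P u * m))"
      using source edge_head'[OF e] by simp
    also have "\<dots> = 0"
      using False e u vertex_mult[of "head G e" u] by (simp flip: mult.assoc)
    finally show ?thesis by simp
  qed
  show "S e * m \<in> insert 0 path_products" if e: "e \<in> arcs G"
  proof (cases p)
    case Nil
    then have [simp]: "u = w" using p by (simp add: awalk_simps)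
    have m': "m = gpath u' q"
      using Nil gpath_target[OF q] by (simp add: m)
    show ?thesis
    proof (cases "tail G e = w")
      case True
      then have e': "awalk w [e] (head G e)"
        using e by (simp add: awalk_simps)
      have qe: "awalk u' (q @ [e]) (head G e)"
        using awalk_appendI[OF q e'] .
      have "gpath u' (q @ [e]) = P (head G e) * S e * gpath u' q"
        using gpath_append[OF q e'] by simp
      then have "S e * m = epath (head G e) [] * gpath u' (q @ [e])"
        using e by (simp add: m' head_ghost vertex_idem' mult.assoc head_ghost')
      then show ?thesis
        using qe awalk_Nil_iff[of "head G e" "head G e"] e wellformed(2)[OF e]
        unfolding path_products_def by blast
    next
      case False
      have "S e * m = S e * (P (tail G e) * (P u * m))"
        using source ghost_tail'[OF e] by simp
      also have "\<dots> = 0"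
        using False e u vertex_mult[of "tail G e" u] by (simp flip: mult.assoc)
      finally show ?thesis by simp
    qed
  next
    case (Cons f r)
    then have f: "f \<in> arcs G" "awalk (head G f) r w"
      using p by (auto simp: awalk_simps)
    then have "S e * m = (if e = f then epath (head G f) r * gpath u' q else 0)"
      using e epath_source[OF f(2)] by (simp add: m Cons mult.assoc ghost_edge' flip: mult.assoc[of "P _"])
    then show ?thesis using f q unfolding path_products_def by auto
  qed
qed

text \<open>
  The span of the path products is a left ideal that contains the local units.
\<close>

lemma L_subset_span: "L \<subseteq> linear_span A path_products"
proof
  fix x assume x: "x \<in> L"
  let ?M = "linear_span A path_products"
  have gen: "g * m \<in> ?M" if "m \<in> ?M" "\<And>m. m \<in> path_products \<Longrightarrow> g * m \<in> insert 0 path_products" for g m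
    using that(1)
  proof (induction rule: span_induct)
    case (incl m)
    then show ?case using that(2)[of m] by (auto intro: linear_span.incl span_zero)
  qed (auto simp: distrib_left K_assoc intro: span_zero span_add span_smult)
  have left: "x * m \<in> ?M" if "m \<in> ?M" for m
    using x that
  proof (induction arbitrary: m rule: sub_induct)
    case (vertex v)
    then show ?case using gen generator_mult_path_product(1) by blast
  next
    case (edge e)
    then show ?case using gen generator_mult_path_product(2) by blast
  next
    case (ghost e)
    then show ?case using gen generator_mult_path_product(3) by blast
  qed (simp_all add: distrib_right mult.assoc span_zero span_add span_smult)
  obtain F where F: "finite F" "F \<subseteq> verts G" "x * (\<Sum>v\<in>F. P v) = x"
    using local_unit[OF x] by metis
  have "P v \<in> ?M" if "v \<in> verts G" for v
  proof -
    have "P v = epath v [] * gpath v []" "awalk v [] v"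
      using that by (simp_all add: vertex_idem awalk_simps)
    then show ?thesis
      unfolding path_products_def by (blast intro: linear_span.incl)
  qed
  then have "(\<Sum>v\<in>F. P v) \<in> ?M"
    using F(2) by (intro span_sum) blast
  from left[OF this] show "x \<in> ?M" using F by simp
qed

section \<open>Central elements spread from a hereditary set\<close>

definition Z :: "'v set \<Rightarrow> 'r set" where
  "Z W = {z \<in> sub W. \<forall>x\<in>sub W. z * x = x * z}"

text \<open>
  The generators of type (b).  Multiplication by a vertex \<open>u\<close>, from either side, cuts out the terms of
  the paths starting at \<open>u\<close>, so that commuting with an edge becomes a relation between two fibres.
\<close>

definition spread :: "'v set \<Rightarrow> 'r \<Rightarrow> 'r" where
  "spread W z = (\<Sum>(u, p)\<in>Arr G W. epath u p * z * gpath u p)"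

definition fibre :: "'v set \<Rightarrow> 'r \<Rightarrow> 'v \<Rightarrow> 'r" where
  "fibre W z u = (\<Sum>p | (u, p) \<in> Arr G W. epath u p * z * gpath u p)"

lemma Arr_Nil: "(u, []) \<in> Arr G W \<longleftrightarrow> u \<in> W \<and> u \<in> verts G"
  by (auto simp: Arr_def awalk_simps)

lemma Arr_Cons: "(u, e # p) \<in> Arr G W \<longleftrightarrow>
    e \<in> arcs G \<and> u = tail G e \<and> u \<notin> W \<and> (head G e, p) \<in> Arr G W"
  by (auto simp: Arr_def awalk_simps)

lemma Arr_awalk: "(u, p) \<in> Arr G W \<Longrightarrow> \<exists>w\<in>W. awalk u p w"
  by (auto simp: Arr_def)

lemma vertex_epath:
  assumes "awalk u p w" "v \<in> verts G"
  shows "P v * epath u p = (if v = u then epath u p else 0)"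
proof -
  have "P v * epath u p = P v * P u * epath u p"
    using epath_source[OF assms(1)] by (simp add: mult.assoc)
  then show ?thesis
    using assms epath_source[OF assms(1)] by (auto simp: vertex_mult)
qed

lemma gpath_vertex:
  assumes "awalk u p w" "v \<in> verts G"
  shows "gpath u p * P v = (if v = u then gpath u p else 0)"
proof -
  have "gpath u p * P v = gpath u p * (P u * P v)"
    using gpath_source[OF assms(1)] by (simp flip: mult.assoc)
  then show ?thesis
    using assms gpath_source[OF assms(1)] by (auto simp: vertex_mult)
qed

lemma spread_vertex:
  assumes "finite (Arr G W)" "u \<in> verts G"
  shows "P u * spread W z = fibre W z u" "spread W z * P u = fibre W z u"
proof -
  let ?t = "\<lambda>(u, p). epath u p * z * gpath u p"
  have fib: "fibre W z u = (\<Sum>x\<in>Arr G W. if fst x = u then ?t x else 0)"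
  proof -
    have "{x \<in> Arr G W. fst x = u} = Pair u ` {p. (u, p) \<in> Arr G W}"
      by force
    then show ?thesis
      using assms by (simp add: sum.inter_filter[symmetric] sum.reindex inj_on_def fibre_def)
  qed
  have "P u * ?t x = (if fst x = u then ?t x else 0)"
     "?t x * P u = (if fst x = u then ?t x else 0)" if x: "x \<in> Arr G W" for x
  proof -
    obtain u' p w where x': "x = (u', p)" "awalk u' p w"
      using Arr_awalk x by (cases x) blast
    show "P u * ?t x = (if fst x = u then ?t x else 0)"
      using vertex_epath[OF x'(2) assms(2)] by (simp add: x'(1) flip: mult.assoc)
    show "?t x * P u = (if fst x = u then ?t x else 0)"
      using gpath_vertex[OF x'(2) assms(2)] by (simp add: x'(1) mult.assoc)
  qed
  then show "P u * spread W z = fibre W z u" "spread W z * P u = fibre W z u"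
    unfolding fib spread_def sum_distrib_left sum_distrib_right
    by (intro sum.cong; force)+
qed

lemma fibre_in:
  assumes "u \<in> W" "u \<in> verts G"
  shows "fibre W z u = P u * z * P u"
proof -
  have "{p. (u, p) \<in> Arr G W} = {[]}"
  proof -
    have "(u, p) \<in> Arr G W \<longleftrightarrow> p = []" for p
      using assms by (cases p) (auto simp: Arr_Nil Arr_Cons)
    then show ?thesis by blast
  qed
  then show ?thesis by (simp add: fibre_def)
qed

text \<open>
  Outside \<open>W\<close>, the arrival paths at the source of \<open>e\<close> that begin with \<open>e\<close> are \<open>e\<close> followed by the arrival
  paths at the range of \<open>e\<close>; multiplication by \<open>e\<close> or \<open>e\<^sup>*\<close> annihilates the others.
\<close>

lemma fibre_edge:
  assumes "finite (Arr G W)" "e \<in> arcs G" "tail G e \<notin> W"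
  shows "fibre W z (tail G e) * E e = E e * fibre W z (head G e)"
    "S e * fibre W z (tail G e) = fibre W z (head G e) * S e"
proof -
  let ?t = "tail G e" and ?h = "head G e"
  have fin: "finite {p. (?t, p) \<in> Arr G W}"
    using finite_vimageI[OF assms(1), of "Pair ?t"] by (simp add: inj_on_def vimage_def)
  have sub: "(#) e ` {p. (?h, p) \<in> Arr G W} \<subseteq> {p. (?t, p) \<in> Arr G W}"
    using assms by (auto simp: Arr_Cons)
  have other: "\<exists>f q. p = f # q \<and> f \<in> arcs G \<and> f \<noteq> e"
    if "p \<in> {p. (?t, p) \<in> Arr G W} - (#) e ` {p. (?h, p) \<in> Arr G W}" for p
    using that assms by (cases p) (auto simp: Arr_Nil Arr_Cons)
  have tgt: "gpath ?h p * P ?h = gpath ?h p" "P ?h * epath ?h p = epath ?h p"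
    if "(?h, p) \<in> Arr G W" for p
    using that Arr_awalk gpath_source epath_source by blast+
  have "fibre W z ?t * E e = (\<Sum>p | (?t, p) \<in> Arr G W. epath ?t p * z * gpath ?t p * E e)"
    by (simp add: fibre_def sum_distrib_right)
  also have "\<dots> = (\<Sum>p\<in>(#) e ` {p. (?h, p) \<in> Arr G W}. epath ?t p * z * gpath ?t p * E e)"
    using other assms(2)
    by (intro sum.mono_neutral_right fin sub) (force simp: mult.assoc ghost_edge)
  also have "\<dots> = (\<Sum>p | (?h, p) \<in> Arr G W. E e * (epath ?h p * z * gpath ?h p))"
    using assms(2) tgt by (subst sum.reindex) (auto simp: mult.assoc ghost_edge intro!: sum.cong)
  finally show "fibre W z ?t * E e = E e * fibre W z ?h"
    by (simp add: fibre_def sum_distrib_left)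
  have "S e * fibre W z ?t = (\<Sum>p | (?t, p) \<in> Arr G W. S e * (epath ?t p * z * gpath ?t p))"
    by (simp add: fibre_def sum_distrib_left)
  also have "\<dots> = (\<Sum>p\<in>(#) e ` {p. (?h, p) \<in> Arr G W}. S e * (epath ?t p * z * gpath ?t p))"
    using other assms(2)
    by (intro sum.mono_neutral_right fin sub) (force simp: mult.assoc ghost_edge')
  also have "\<dots> = (\<Sum>p | (?h, p) \<in> Arr G W. epath ?h p * z * gpath ?h p * S e)"
    using assms(2) tgt
    by (subst sum.reindex)
      (auto simp: mult.assoc ghost_edge' simp flip: mult.assoc[of "P _"] intro!: sum.cong)
  finally show "S e * fibre W z ?t = fibre W z ?h * S e"
    by (simp add: fibre_def sum_distrib_right)
qed

text \<open>
  It suffices to commute with the generators.  For an edge from outside \<open>W\<close> this is the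
  shift of arrival paths by one edge; on \<open>W\<close>, where the only arrival paths have length \<open>0\<close>, it is the
  centrality of \<open>z\<close> in \<open>L(W)\<close>.
\<close>

lemma spread_commutes:
  assumes W: "hereditary G W" and fin: "finite (Arr G W)" and z: "z \<in> Z W" and x: "x \<in> L"
  shows "spread W z * x = x * spread W z"
proof -
  have comm: "z * y = y * z" if "y \<in> sub W" for y
    using z that by (simp add: Z_def)
  have WV: "W \<subseteq> verts G" using W by (simp add: hereditary_def)
  have edge: "fibre W z (tail G e) * E e = E e * fibre W z (head G e) \<and>
    S e * fibre W z (tail G e) = fibre W z (head G e) * S e" if e: "e \<in> arcs G" for e
  proof (cases "tail G e \<in> W")
    case True
    then have h: "head G e \<in> W" using hereditary_head[OF W e] by simp
    have z: "z * P (tail G e) = P (tail G e) * z" "z * P (head G e) = P (head G e) * z"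
      "z * E e = E e * z" "z * S e = S e * z"
      using True h e by (auto intro!: comm sub_vertex sub_edge sub_ghost)
    have "P (tail G e) * z * P (tail G e) * E e = E e * z"
      using z tail_edge[OF e] by (metis mult.assoc)
    moreover have "E e * (P (head G e) * z * P (head G e)) = E e * z"
      using z edge_head[OF e] by (metis mult.assoc)
    moreover have "S e * (P (tail G e) * z * P (tail G e)) = S e * z"
      using z ghost_tail[OF e] by (metis mult.assoc)
    moreover have "P (head G e) * z * P (head G e) * S e = S e * z"
      using z head_ghost[OF e] by (metis mult.assoc)
    ultimately show ?thesis
      using True h WV by (simp add: fibre_in subset_iff)
  next
    case False
    then show ?thesis using fibre_edge[OF fin e] by simp
  qed
  show ?thesis
    using x
  proof (rule commute_sub)
    show "spread W z * P v = P v * spread W z" if "v \<in> verts G" for v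
      using spread_vertex[OF fin that] by simp
    show "spread W z * E e = E e * spread W z" if e: "e \<in> arcs G" for e
    proof -
      have "spread W z * E e = spread W z * P (tail G e) * E e"
        using tail_edge[OF e] by (simp add: mult.assoc)
      also have "\<dots> = E e * (P (head G e) * spread W z)"
        using edge[OF e] e by (simp add: spread_vertex[OF fin])
      also have "\<dots> = E e * spread W z"
        using edge_head'[OF e] .
      finally show ?thesis .
    qed
    show "spread W z * S e = S e * spread W z" if e: "e \<in> arcs G" for e
    proof -
      have "spread W z * S e = spread W z * P (head G e) * S e"
        using head_ghost[OF e] by (simp add: mult.assoc)
      also have "\<dots> = S e * (P (tail G e) * spread W z)"
        using edge[OF e] e by (simp add: spread_vertex[OF fin])
      also have "\<dots> = S e * spread W z"
        using ghost_tail'[OF e] .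
      finally show ?thesis .
    qed
  qed
qed

lemma spread_central:
  assumes "hereditary G W" "finite (Arr G W)" "z \<in> Z W"
  shows "spread W z \<in> Z (verts G)"
proof -
  have "z \<in> L"
    using assms sub_mono[of W "verts G"] by (auto simp: Z_def hereditary_def)
  then have "spread W z \<in> L"
    unfolding spread_def using Arr_awalk
    by (intro sub_sum) (fastforce intro: sub_mult path_in_L)
  then show ?thesis
    using spread_commutes[OF assms] by (simp add: Z_def)
qed

section \<open>The idempotent of a hereditary set\<close>

definition idem :: "'v set \<Rightarrow> 'r" where
  "idem W = (\<Sum>(u, p)\<in>Arr G W. epath u p * gpath u p)"

lemma finite_of_Arr:
  assumes "finite (Arr G W)" "W \<subseteq> verts G"
  shows "finite W"
proof -
  have "(\<lambda>w. (w, [])) ` W \<subseteq> Arr G W"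
    using assms by (auto simp: Arr_Nil)
  then show ?thesis
    using assms(1) finite_subset finite_imageD[of "\<lambda>w. (w, [])" W] by (auto simp: inj_on_def)
qed

lemma sub_unit:
  assumes "finite W" "W \<subseteq> verts G" "x \<in> sub W"
  shows "(\<Sum>v\<in>W. P v) * x = x" "x * (\<Sum>v\<in>W. P v) = x"
proof -
  let ?U = "\<Sum>v\<in>W. P v"
  have U: "?U * P v = P v" "P v * ?U = P v" if "v \<in> W" for v
    using vertex_sum_mult[OF assms(1,2), of v] that assms by auto
  have "?U * x = x \<and> x * ?U = x"
    using assms(3)
  proof (induction rule: sub_induct)
    case (edge e)
    then have "?U * (P (tail G e) * E e) = P (tail G e) * E e"
      "(E e * P (head G e)) * ?U = E e * P (head G e)"
      using U by (simp_all add: mult.assoc flip: mult.assoc[of ?U])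
    then show ?case using edge by (simp add: tail_edge edge_head)
  next
    case (ghost e)
    then have "?U * (P (head G e) * S e) = P (head G e) * S e"
      "(S e * P (tail G e)) * ?U = S e * P (tail G e)"
      using U by (simp_all add: mult.assoc flip: mult.assoc[of ?U])
    then show ?case using ghost by (simp add: head_ghost ghost_tail)
  next
    case (smult c x)
    then show ?case by (simp add: mult.assoc K_assoc)
  next
    case (mult x y)
    then show ?case by (metis mult.assoc)
  qed (simp_all add: U distrib_left distrib_right)
  then show "?U * x = x" "x * ?U = x" by auto
qed

lemma Arr_unit:
  assumes "finite W" "W \<subseteq> verts G" "(u, p) \<in> Arr G W"
  shows "epath u p * (\<Sum>v\<in>W. P v) = epath u p"
proof -
  obtain w where w: "w \<in> W" "awalk u p w"
    using Arr_awalk[OF assms(3)] by blast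
  have "epath u p * (\<Sum>v\<in>W. P v) = epath u p * (P w * (\<Sum>v\<in>W. P v))"
    using epath_target[OF w(2)] by (simp flip: mult.assoc)
  then show ?thesis
    using vertex_sum_mult[OF assms(1,2), of w] w assms(2) epath_target[OF w(2)] by auto
qed

lemma restrict_central:
  assumes W: "hereditary G W" "finite W" and z: "z \<in> Z (verts G)"
    and corner: "\<And>w. w \<in> W \<Longrightarrow> P w * z \<in> sub W"
  shows "(\<Sum>v\<in>W. P v) * z \<in> Z W"
proof -
  let ?U = "\<Sum>v\<in>W. P v"
  have WV: "W \<subseteq> verts G" using W by (simp add: hereditary_def)
  have "?U * z * x = x * (?U * z)" if x: "x \<in> sub W" for x
  proof -
    have xz: "z * x = x * z" and "z * ?U = ?U * z"
      using z x sub_mono[OF WV] WV by (auto simp: Z_def intro!: sub_sum sub_vertex)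
    then have "?U * z * x = z * (?U * x)"
      by (simp flip: mult.assoc)
    also have "\<dots> = x * ?U * z"
      using sub_unit[OF W(2) WV x] xz by simp
    finally show ?thesis by (simp add: mult.assoc)
  qed
  moreover have "?U * z \<in> sub W"
    unfolding sum_distrib_right by (intro sub_sum corner)
  ultimately show ?thesis by (simp add: Z_def)
qed

text \<open>
  As \<open>W\<close> is finite, \<open>L(W)\<close> has an identity, which is central in it; this makes the centrality of
  \<open>e(W)\<close> a case of that of the spread elements.
\<close>

lemma idem_spread:
  assumes "finite W" "W \<subseteq> verts G"
  shows "idem W = spread W (\<Sum>v\<in>W. P v)"
  unfolding idem_def spread_def using Arr_unit[OF assms] by (intro sum.cong) auto

lemma idem_central:
  assumes "hereditary G W" "finite (Arr G W)"
  shows "idem W \<in> Z (verts G)"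
proof -
  have W: "W \<subseteq> verts G" "finite W"
    using assms finite_of_Arr by (auto simp: hereditary_def)
  then have "(\<Sum>v\<in>W. P v) \<in> Z W"
    using sub_unit by (auto simp: Z_def intro!: sub_sum sub_vertex)
  then show ?thesis
    using spread_central[OF assms] idem_spread[OF W(2,1)] by simp
qed

text \<open>
  Moving \<open>z\<close> past the first factor of \<open>p p\<^sup>*\<close> brings it to the range of \<open>p\<close>, which lies in \<open>W\<close>.  So
  the component \<open>z e(W)\<close> of \<open>z\<close> depends only on what \<open>z\<close> is on \<open>W\<close>.
\<close>

lemma central_mult_idem:
  assumes "z \<in> Z (verts G)"
  shows "z * idem W = (\<Sum>(u, p)\<in>Arr G W. epath u p * z * gpath u p)"
  unfolding idem_def sum_distrib_left
proof (intro sum.cong refl)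
  fix x assume "x \<in> Arr G W"
  then obtain u p w where x: "x = (u, p)" "awalk u p w"
    using Arr_awalk by (cases x) blast
  then have "z * epath u p = epath u p * z"
    using assms path_in_L by (auto simp: Z_def)
  then show "z * (case x of (u, p) \<Rightarrow> epath u p * gpath u p) =
      (case x of (u, p) \<Rightarrow> epath u p * z * gpath u p)"
    using x(1) by (simp flip: mult.assoc)
qed

section \<open>Corners\<close>

lemma path_products_cases:
  assumes "m \<in> path_products"
  obtains u p u' q w where "m = epath u p * gpath u' q" "awalk u p w" "awalk u' q w"
  using assms unfolding path_products_def by blast

lemma corner_path_product:
  assumes "m \<in> path_products" "v \<in> verts G"
  obtains "P v * m * P v = 0"
    | p q w where "P v * m * P v = epath v p * gpath v q" "awalk v p w" "awalk v q w"
proof -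
  obtain u p u' q w where m: "m = epath u p * gpath u' q" "awalk u p w" "awalk u' q w"
    using assms(1) by (rule path_products_cases)
  have "P v * m * P v = (P v * epath u p) * (gpath u' q * P v)"
    by (simp add: m mult.assoc)
  then show ?thesis
    using that(1) that(2)[of p q w] m(2,3) vertex_epath[OF m(2) assms(2)] gpath_vertex[OF m(3) assms(2)]
    by (cases "u = v"; cases "u' = v") simp_all
qed

text \<open>
  Paths that start in a hereditary set stay in it, so \<open>v x v\<close> is a combination of products \<open>p q\<^sup>*\<close> of
  paths inside \<open>W\<close>.
\<close>

lemma corner_in_sub:
  assumes "hereditary G W" "v \<in> W" "x \<in> L"
  shows "P v * x * P v \<in> sub W"
proof -
  have v: "v \<in> verts G" using assms by (auto simp: hereditary_def)
  have "x \<in> linear_span A path_products"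
    using assms(3) L_subset_span by blast
  then show ?thesis
  proof (induction rule: span_induct)
    case (incl m)
    then show ?case
      using path_in_sub[OF assms(1) _ assms(2)]
      by (cases rule: corner_path_product[OF incl v]) (auto intro: sub_zero sub_mult)
  qed (auto simp: distrib_left distrib_right mult.assoc K_assoc intro: sub_zero sub_add sub_smult)
qed

lemma corner_at_sink:
  assumes "v \<in> verts G" "out_arcs G v = {}" "x \<in> L"
  shows "\<exists>c. P v * x * P v = K c * P v"
proof -
  have triv: "p = []" if "awalk v p w" for p w
    using that assms(2) by (cases p) (auto simp: awalk_simps)
  have "x \<in> linear_span A path_products"
    using assms(3) L_subset_span by blast
  then show ?thesis
  proof (induction rule: span_induct)
    case zero
    show ?case by (intro exI[of _ 0]) (simp add: K_zero)
  next
    case (incl m)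
    then show ?case
    proof (cases rule: corner_path_product[OF incl assms(1)])
      case 1
      then show ?thesis by (intro exI[of _ 0]) (simp add: K_zero)
    next
      case (2 p q w)
      then show ?thesis
        using triv[OF 2(2)] triv[OF 2(3)] assms(1)
        by (intro exI[of _ 1]) (simp add: K_one vertex_idem)
    qed
  next
    case (add x y)
    then obtain c d where "P v * x * P v = K c * P v" "P v * y * P v = K d * P v" by blast
    then show ?case by (intro exI[of _ "c + d"]) (simp add: K_add distrib_left distrib_right)
  next
    case (smult c x)
    then obtain d where "P v * x * P v = K d * P v" by blast
    moreover have "P v * (K c * x) * P v = K c * (P v * x * P v)"
      by (simp only: K_assoc mult.assoc)
    ultimately show ?case by (intro exI[of _ "c * d"]) (simp only: K_mult mult.assoc)
  qed
qed

section \<open>Central elements along a cycle with an exit\<close>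

lemma central_vertex:
  assumes "z \<in> Z (verts G)" "v \<in> verts G"
  shows "P v * z * P v = P v * z" "z * P v = P v * z"
proof -
  show *: "z * P v = P v * z"
    using assms by (auto simp: Z_def intro!: sub_vertex)
  then show "P v * z * P v = P v * z"
    using vertex_idem[OF assms(2)] by (metis mult.assoc)
qed

text \<open>
  If \<open>n\<close> exceeds the lengths of \<open>p\<close> and \<open>q\<close>, then \<open>(C\<^sup>n)\<^sup>* p\<close> is \<open>0\<close> or \<open>a\<^sup>*\<close> with \<open>C\<^sup>n = p a\<close>, and
  \<open>q\<^sup>* C\<^sup>m\<close> is \<open>0\<close> or \<open>b\<close> with \<open>C\<^sup>m = q b\<close>.  With \<open>m\<close> large against \<open>n\<close>, the path \<open>b\<close> is the longer one, so
  \<open>a\<^sup>* b\<close> is \<open>0\<close> or a suffix of \<open>C\<^sup>m\<close> that starts at \<open>v\<close>, that is, a power of \<open>C\<close>.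
\<close>

lemma cycle_compress:
  assumes C: "awalk v C v" "distinct (map (tail G) C)" "C \<noteq> []"
    and m: "m \<in> path_products"
  shows "\<exists>N. \<forall>n\<ge>N. \<forall>n'\<ge>n + N. gpath v (cycle_power C n) * m * epath v (cycle_power C n')
    \<in> linear_span A (range (\<lambda>i. epath v (cycle_power C i)))"
proof -
  let ?C = "cycle_power C"
  let ?S = "linear_span A (range (\<lambda>i. epath v (?C i)))"
  have Cn: "awalk v (?C n) v" for n
    using awalk_cycle_power[OF C(1)] .
  obtain u p u' q w where m: "m = epath u p * gpath u' q" "awalk u p w" "awalk u' q w"
    using m by (rule path_products_cases)
  have "gpath v (?C n) * m * epath v (?C n') \<in> ?S"
    if n: "Suc (length p + length q) \<le> n" "n + Suc (length p + length q) \<le> n'" for n n'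
  proof (cases "u = v \<and> u' = v")
    case False
    have "gpath v (?C n) * epath u p = gpath v (?C n) * P v * epath u p"
      using gpath_source[OF Cn] by simp
    moreover have "gpath u' q * epath v (?C n') = gpath u' q * (P v * epath v (?C n'))"
      using epath_source[OF Cn] by simp
    moreover have "P v * epath u p = 0 \<or> gpath u' q * P v = 0"
      using False vertex_epath[OF m(2), of v] gpath_vertex[OF m(3), of v] C(1) by auto
    ultimately have "gpath v (?C n) * epath u p = 0 \<or> gpath u' q * epath v (?C n') = 0"
      by (metis mult.assoc mult_zero_left mult_zero_right)
    then have "gpath v (?C n) * epath u p * (gpath u' q * epath v (?C n')) = 0"
      by auto
    then show ?thesis
      by (simp add: m(1) mult.assoc span_zero)
  next
    case True
    then have m': "m = epath v p * gpath v q" "awalk v p w" "awalk v q w"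
      using m by auto
    have split: "gpath v (?C n) * m * epath v (?C n') =
        gpath v (?C n) * epath v p * (gpath v q * epath v (?C n'))"
      by (simp add: m'(1) mult.assoc)
    have len: "n \<le> length (?C n)"
      using C(3) by (simp add: length_cycle_power Suc_leI)
    \<comment> \<open>Makes \<open>b\<close> strictly longer than \<open>a\<close> below.\<close>
    have "length (?C n) + (n' - n) \<le> length (?C n')"
    proof -
      have "n * length C + (n' - n) * 1 \<le> n * length C + (n' - n) * length C"
        using C(3) by (intro add_left_mono mult_le_mono2) (simp add: Suc_leI)
      also have "\<dots> = n' * length C"
        using n by (simp flip: add_mult_distrib)
      finally show ?thesis by (simp add: length_cycle_power)
    qed
    with n have len': "length (?C n) + length p + length q < length (?C n')"
      by linarith
    show ?thesis
    proof (cases rule: gpath_epath_cases[OF Cn[of n] m'(2)])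
      case 1
      then show ?thesis using split by (simp add: span_zero)
    next
      case (2 r)
      then show ?thesis using len n by simp
    next
      case (3 a)
      show ?thesis
      proof (cases rule: gpath_epath_cases[OF m'(3) Cn[of n']])
        case 1
        then show ?thesis using split by (simp add: span_zero)
      next
        case (3 r)
        then show ?thesis using len' by simp
      next
        case b: (2 b)
        show ?thesis
        proof (cases rule: gpath_epath_cases[OF 3(2) b(2)])
          case 1
          then show ?thesis using split 3 b by (simp add: span_zero)
        next
          case c: (2 c)
          obtain i where "c = ?C i"
            using suffix_cycle_power[OF C(1,2), of n' "q @ a" c] c b by auto
          then show ?thesis
            using split 3 b c by (auto intro: linear_span.incl)
        next
          case (3 c)
          then show ?thesis using len' b \<open>?C n = p @ a\<close> by simp
        qed
      qed
    qed
  qed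
  then show ?thesis by blast
qed

lemma cycle_compress_L:
  assumes C: "awalk v C v" "distinct (map (tail G) C)" "C \<noteq> []" and x: "x \<in> L"
  shows "\<exists>N. \<forall>n\<ge>N. \<forall>n'\<ge>n + N. gpath v (cycle_power C n) * x * epath v (cycle_power C n')
    \<in> linear_span A (range (\<lambda>i. epath v (cycle_power C i)))"
proof -
  have "x \<in> linear_span A path_products"
    using x L_subset_span by blast
  then show ?thesis
  proof (induction rule: span_induct)
    case (incl m)
    then show ?case by (rule cycle_compress[OF C])
  next
    case (add x y)
    then obtain M N where
      "\<forall>n\<ge>M. \<forall>n'\<ge>n + M. gpath v (cycle_power C n) * x * epath v (cycle_power C n')
        \<in> linear_span A (range (\<lambda>i. epath v (cycle_power C i)))"
      "\<forall>n\<ge>N. \<forall>n'\<ge>n + N. gpath v (cycle_power C n) * y * epath v (cycle_power C n')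
        \<in> linear_span A (range (\<lambda>i. epath v (cycle_power C i)))"
      by blast
    then show ?case
      by (intro exI[of _ "M + N"]) (simp add: distrib_left distrib_right span_add)
  next
    case (smult c x)
    then show ?case by (simp add: K_assoc mult.assoc) (meson span_smult)
  qed (simp add: span_zero)
qed

lemma span_range_sum:
  assumes "x \<in> linear_span A (range f)"
  shows "\<exists>a (k :: nat). x = (\<Sum>i<k. K (a i) * f i)"
  using assms
proof (induction rule: span_induct)
  case zero
  show ?case by (intro exI[of _ "\<lambda>_. 0"] exI[of _ 0]) simp
next
  case (incl x)
  then obtain i where "x = f i" by blast
  then have "x = (\<Sum>j<Suc i. K (if j = i then 1 else 0) * f j)"
    by (simp add: K_one K_zero if_distrib[of "\<lambda>x. x * _"] if_distrib[of K] cong: if_cong)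
  then show ?case by (intro exI)
next
  case (add x y)
  then obtain a k b l where x: "x = (\<Sum>i<k. K (a i) * f i)" and y: "y = (\<Sum>i<l. K (b i) * f i)"
    by blast
  have pad: "(\<Sum>i<k. K (a i) * f i) = (\<Sum>i<k + l. K (if i < k then a i else 0) * f i)"
    for k l :: nat and a
    by (rule sum.mono_neutral_cong_left) (auto simp: K_zero)
  have "x + y = (\<Sum>i<k + l. K ((if i < k then a i else 0) + (if i < l then b i else 0)) * f i)"
    unfolding x y pad[of a k l] pad[of b l k]
    by (simp add: K_add distrib_right sum.distrib add.commute[of l k])
  then show ?case by (intro exI)
next
  case (smult c x)
  then obtain a k where "x = (\<Sum>i<k. K (a i) * f i)" by blast
  then have "K c * x = (\<Sum>i<k. K (c * a i) * f i)"
    by (simp add: sum_distrib_left K_mult mult.assoc)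
  then show ?case by (intro exI)
qed

text \<open>
  For large \<open>N\<close>, centrality of \<open>z\<close> gives \<open>z C\<^sup>N = (C\<^sup>N)\<^sup>* z C\<^sup>2\<^sup>N\<close>, which is a polynomial
  \<open>\<Sum> a\<^sub>i C\<^sup>i\<close>.  The exit \<open>f\<close> reads off its coefficients: \<open>f\<^sup>* (C\<^sup>m)\<^sup>* C\<^sup>i f\<close> is \<open>r(f)\<close> if \<open>m = i\<close> and \<open>0\<close>
  otherwise.  As \<open>z\<close> can be moved out to the left, only \<open>a\<^sub>N\<close> survives, and \<open>z C\<^sup>N = a\<^sub>N C\<^sup>N\<close> is cancelled
  to \<open>z v = a\<^sub>N v\<close>.
\<close>

lemma scalar_at_exit:
  assumes z: "z \<in> Z (verts G)" and C: "awalk v C v" "distinct (map (tail G) C)" "C \<noteq> []"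
    and f: "f \<in> arcs G" "tail G f = v" "f \<notin> set C"
  shows "\<exists>c. P v * z = K c * P v"
proof -
  let ?c = "\<lambda>n. epath v (cycle_power C n)" and ?g = "\<lambda>n. gpath v (cycle_power C n)"
  have v: "v \<in> verts G" using C by auto
  have Cn: "awalk v (cycle_power C n) v" for n
    using awalk_cycle_power[OF C(1)] .
  have gc: "?g m * ?c n = (if m \<le> n then ?c (n - m) else ?g (m - n))" for m n
    using gpath_epath_shorter[OF Cn Cn, of "min m n" "max m n - min m n"]
    by (simp add: min_def max_def flip: cycle_power_add split: if_splits)
  have kill: "S f * ?c (Suc n) = 0" "?g (Suc n) * E f = 0" for n
  proof -
    obtain e D where D: "C = e # D" using C(3) by (cases C) auto
    then have "e \<in> arcs G" "e \<noteq> f" using C(1) f by (auto simp: awalk_Cons_iff)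
    then show "S f * ?c (Suc n) = 0" "?g (Suc n) * E f = 0"
      using f D by (simp_all add: ghost_edge' ghost_edge mult.assoc)
  qed
  \<comment> \<open>Powers of \<open>C\<close> with different exponents are orthogonal when seen from the exit \<open>f\<close>.\<close>
  have sep: "S f * ?g m * ?c n * E f = (if m = n then P (head G f) else 0)" for m n
  proof -
    have eq: "S f * ?g m * ?c n * E f = S f * (?g m * ?c n) * E f"
      by (simp only: mult.assoc)
    show ?thesis
    proof (cases m n rule: linorder_cases)
      case less
      then obtain k where k: "n - m = Suc k" by (metis Suc_diff_Suc)
      then show ?thesis unfolding eq gc k using less kill(1)[of k] by simp
    next
      case equal
      then show ?thesis
        unfolding eq gc using f tail_edge[OF f(1)] by (simp add: mult.assoc ghost_edge)
    next
      case greater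
      then obtain k where k: "m - n = Suc k" by (metis Suc_diff_Suc)
      then show ?thesis unfolding eq gc k using greater kill(2)[of k] by (simp only: mult.assoc) simp
    qed
  qed
  have zc: "z * x = x * z" if "x \<in> L" for x
    using z that by (simp add: Z_def)
  obtain N where "?g N * z * ?c (N + N) \<in> linear_span A (range ?c)"
    using cycle_compress_L[OF C, of z] z by (auto simp: Z_def)
  moreover have "?g N * z * ?c (N + N) = z * ?c N"
    using zc[OF path_in_L(2)[OF Cn], of N] gc[of N "N + N"]
    by (metis add_diff_cancel_left' le_add1 mult.assoc)
  ultimately obtain a and k :: nat where a: "z * ?c N = (\<Sum>i<k. K (a i) * ?c i)"
    using span_range_sum[of _ ?c] by metis
  have coeff: "S f * ?g m * (z * ?c N) * E f = (if m < k then K (a m) * P (head G f) else 0)" for m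
  proof -
    have "S f * ?g m * (z * ?c N) * E f = (\<Sum>i<k. K (a i) * (S f * ?g m * ?c i * E f))"
      unfolding a sum_distrib_left sum_distrib_right
      by (simp add: K_assoc mult.assoc)
    also have "\<dots> = (\<Sum>i<k. if m = i then K (a m) * P (head G f) else 0)"
      unfolding sep by (intro sum.cong) auto
    finally show ?thesis by simp
  qed
  have zero: "a m = 0" if "m \<noteq> N" "m < k" for m
  proof -
    have "S f * ?g m \<in> L"
      using f wellformed by (intro sub_mult sub_ghost path_in_L(2)[OF Cn]) auto
    then have comm: "S f * ?g m * z = z * (S f * ?g m)"
      using zc by simp
    have "S f * ?g m * (z * ?c N) * E f = S f * ?g m * z * (?c N * E f)"
      by (simp only: mult.assoc)
    also have "\<dots> = z * (S f * ?g m) * (?c N * E f)"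
      by (simp only: comm)
    also have "\<dots> = z * (S f * ?g m * ?c N * E f)"
      by (simp only: mult.assoc)
    finally have "S f * ?g m * (z * ?c N) * E f = z * (S f * ?g m * ?c N * E f)" .
    then have "K (a m) * P (head G f) = 0"
      using that coeff[of m] by (simp add: sep)
    then show ?thesis
      using f vertex_nonzero by (simp add: K_eq_zero)
  qed
  \<comment> \<open>The expansion may stop before the exponent \<open>N\<close>; the coefficient of \<open>C\<^sup>N\<close> is then \<open>0\<close>.\<close>
  define c where "c = (if N < k then a N else 0)"
  have "z * ?c N = (\<Sum>i<k. if i = N then K c * ?c N else 0)"
    unfolding a using zero by (intro sum.cong) (auto simp: c_def K_zero)
  also have "\<dots> = K c * ?c N"
    by (simp add: c_def K_zero)
  finally have "?g N * (z * ?c N) = K c * P v"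
    by (simp add: K_assoc gc)
  moreover have "?g N * (z * ?c N) = z * P v"
    using zc[OF path_in_L(2)[OF Cn], of N] gpath_epath_same[OF Cn, of N]
    by (metis mult.assoc)
  ultimately show ?thesis
    using central_vertex(2)[OF z v] by auto
qed

text \<open>
  By \<open>r(p) z = p\<^sup>* z p\<close> for central \<open>z\<close>.
\<close>

lemma scalar_along_path:
  assumes z: "z \<in> Z (verts G)" and p: "awalk u p w" and c: "P u * z = K c * P u"
  shows "P w * z = K c * P w"
proof -
  have zp: "z * epath u p = epath u p * z"
    using z path_in_L[OF p] by (simp add: Z_def)
  have "P w * z = gpath u p * (z * epath u p)"
    using z p awalk_last_in_verts[OF p] central_vertex(2)[OF z, of w]
    by (simp add: zp gpath_epath_same[OF p] flip: mult.assoc)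
  also have "\<dots> = gpath u p * P u * (z * epath u p)"
    by (simp only: gpath_source[OF p])
  also have "\<dots> = gpath u p * (P u * z) * epath u p"
    by (simp only: mult.assoc)
  also have "\<dots> = K c * (gpath u p * P u * epath u p)"
    unfolding c by (simp only: K_assoc mult.assoc)
  also have "\<dots> = K c * P w"
    by (simp only: gpath_source[OF p] gpath_epath_same[OF p])
  finally show ?thesis .
qed

lemma support_along_path:
  assumes z: "z \<in> Z (verts G)" and p: "awalk u p w" and c: "P u * z = 0"
  shows "P w * z = 0"
  using scalar_along_path[OF z p, of 0] c by (simp add: K_zero)

lemma scalar_on_cycle:
  assumes z: "z \<in> Z (verts G)" and C: "cycle C" "\<not> NE_cycle G C" and v: "v \<in> cycle_verts G C"
  shows "\<exists>c. P v * z = K c * P v"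
proof -
  obtain f where f: "f \<in> arcs G" "f \<notin> set C" "tail G f \<in> cycle_verts G C"
    using C by (auto simp: NE_cycle_def)
  obtain D where D: "awalk (tail G f) D (tail G f)" "cycle D" "set D = set C"
    using rotate_cycle[OF C(1) f(3)] by metis
  then obtain c where "P (tail G f) * z = K c * P (tail G f)"
    using scalar_at_exit[OF z D(1) _ _ f(1)] f(2) by (auto simp: cycle_iff)
  moreover obtain p where "awalk (tail G f) p v"
    using cycle_connected[OF C(1) f(3) v] .
  ultimately show ?thesis using scalar_along_path[OF z] by blast
qed

section \<open>The support of a central element\<close>

definition support :: "'r \<Rightarrow> 'v set" where
  "support z = {v \<in> verts G. P v * z \<noteq> 0}"

lemma finite_support:
  assumes "z \<in> L"
  shows "finite (support z)"
proof -
  obtain F where F: "finite F" "F \<subseteq> verts G" "(\<Sum>v\<in>F. P v) * z = z"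
    using local_unit[OF assms] by metis
  have "P v * z = 0" if "v \<in> verts G" "v \<notin> F" for v
    using vertex_sum_mult(2)[OF F(1,2) that(1)] F(3) that(2) by (metis mult.assoc mult_zero_left)
  then have "support z \<subseteq> F"
    by (auto simp: support_def)
  then show ?thesis using F(1) finite_subset by blast
qed

lemma zero_if_support_empty:
  assumes "z \<in> L" "support z = {}"
  shows "z = 0"
proof -
  obtain F where F: "F \<subseteq> verts G" "(\<Sum>v\<in>F. P v) * z = z"
    using local_unit[OF assms(1)] by metis
  have "(\<Sum>v\<in>F. P v) * z = 0"
    unfolding sum_distrib_right using assms(2) F(1) by (intro sum.neutral) (auto simp: support_def)
  with F(2) show ?thesis by simp
qed

text \<open>
  By \<open>v z = \<Sum> e (r(e) z) e\<^sup>*\<close>.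
\<close>

lemma successor_in_support:
  assumes z: "z \<in> Z (verts G)" and v: "v \<in> support z" "out_arcs G v \<noteq> {}"
  shows "\<exists>e\<in>arcs G. tail G e = v \<and> head G e \<in> support z"
proof (rule ccontr)
  assume none: "\<not> ?thesis"
  have v': "v \<in> verts G" using v by (simp add: support_def)
  have "E e * S e * z = 0" if e: "e \<in> out_arcs G v" for e
  proof -
    have "head G e \<notin> support z"
      using none e by auto
    then have "P (head G e) * z = 0"
      using e by (simp add: support_def)
    moreover have "S e \<in> L"
      using e by (intro sub_ghost) auto
    then have "S e * z = z * S e"
      using z by (simp add: Z_def)
    moreover have "z * P (head G e) = P (head G e) * z"
      using central_vertex(2)[OF z] e by auto
    ultimately have "S e * z = 0"
      using head_ghost[of e] e by (metis in_out_arcs_conv mult.assoc mult_zero_left)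
    then show ?thesis by (simp add: mult.assoc)
  qed
  then have "P v * z = 0"
    by (simp add: vertex_sum[OF v' v(2)] sum_distrib_right)
  then show False using v by (simp add: support_def)
qed

text \<open>
  All vertices of an arrival path lie in the support, because \<open>z\<close> vanishes at the range of a path if
  it vanishes at the source.  An arrival path longer than the size of the support contains a cycle
  outside \<open>W\<close> from which \<open>W\<close> is reached.  If this cycle has no exit, then \<open>W\<close> meets it and, being
  hereditary, contains it; otherwise \<open>z\<close> is scalar on it, and \<open>absorb\<close> puts it into \<open>W\<close>.
\<close>

lemma finite_Arr_of_support:
  assumes z: "z \<in> Z (verts G)" and W: "hereditary G W" "W \<subseteq> support z"
    and absorb: "\<And>u p w c. \<lbrakk>w \<in> W; awalk u p w; P u * z = K c * P u\<rbrakk> \<Longrightarrow> u \<in> W"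
  shows "finite (Arr G W)"
proof -
  let ?S = "support z"
  have fin: "finite ?S" using z finite_support by (simp add: Z_def)
  have pred: "u \<in> ?S" if "awalk u p w" "w \<in> W" for u p w
    using support_along_path[OF z that(1)] that W(2) by (auto simp: support_def)
  have tails: "tail G ` set p \<subseteq> ?S" if "awalk u p w" "w \<in> W" for u p w
  proof
    fix d assume "d \<in> tail G ` set p"
    then obtain e where "e \<in> set p" "d = tail G e" by blast
    then obtain q where "awalk d q w"
      using walk_from_arc[OF \<open>awalk u p w\<close>] by blast
    then show "d \<in> ?S" using pred \<open>w \<in> W\<close> by blast
  qed
  have short: "length p \<le> card ?S" if up: "(u, p) \<in> Arr G W" for u p
  proof (rule ccontr)
    assume long: "\<not> length p \<le> card ?S"
    obtain w where w: "w \<in> W" "awalk u p w" "\<forall>e\<in>set p. tail G e \<notin> W"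
      using up by (auto simp: Arr_def)
    obtain C where C: "cycle C" "set C \<subseteq> set p"
      using cycle_in_long_walk[OF w(2) fin tails[OF w(2,1)]] long by auto
    then obtain e where e: "e \<in> set C" by (cases C) (auto simp: cycle_iff)
    let ?d = "tail G e"
    have d: "?d \<in> cycle_verts G C" using e by (simp add: cycle_verts_def)
    have dW: "?d \<notin> W" using w(3) e C(2) by blast
    obtain q where q: "awalk ?d q w"
      using walk_from_arc[OF w(2)] e C(2) by blast
    show False
    proof (cases "NE_cycle G C")
      case True
      then have "w \<in> cycle_verts G C"
        using awalk_in_hereditary[OF q hereditary_NE_cycle d] by simp
      then obtain r where "awalk w r ?d"
        using cycle_connected[OF C(1) _ d] by metis
      from awalk_in_hereditary[OF this W(1) w(1)] dW show False by simp
    next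
      case False
      then obtain c where "P ?d * z = K c * P ?d"
        using scalar_on_cycle[OF z C(1) _ d] by blast
      from absorb[OF w(1) q this] dW show False by simp
    qed
  qed
  have "Arr G W \<subseteq> ?S \<times> {p. set p \<subseteq> (\<Union>v\<in>?S. out_arcs G v) \<and> length p \<le> card ?S}"
  proof
    fix x assume "x \<in> Arr G W"
    then obtain u p w where x: "x = (u, p)" "(u, p) \<in> Arr G W" and w: "w \<in> W" "awalk u p w"
      by (auto simp: Arr_def)
    have "set p \<subseteq> arcs G" using w(2) by auto
    then show "x \<in> ?S \<times> {p. set p \<subseteq> (\<Union>v\<in>?S. out_arcs G v) \<and> length p \<le> card ?S}"
      using pred[OF w(2,1)] tails[OF w(2,1)] short[OF x(2)] x(1)
      by (auto simp: subset_iff image_subset_iff)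
  qed
  moreover have "finite (\<Union>v\<in>?S. out_arcs G v)"
    using fin out_arcs_finite by (auto simp: support_def)
  then have "finite {p. set p \<subseteq> (\<Union>v\<in>?S. out_arcs G v) \<and> length p \<le> card ?S}"
    by (rule finite_lists_length_le)
  ultimately show ?thesis
    using fin by (auto intro: finite_subset)
qed

section \<open>The center\<close>

definition central_generators :: "'r set" where
  "central_generators =
     {idem W | W. finite W \<and> W \<noteq> {} \<and> finitary G W}
   \<union> {spread (cycle_verts G C) z | C z.
        NE_cycle G C \<and> finitary G (cycle_verts G C) \<and> z \<in> Z (cycle_verts G C)}"

text \<open>
  If \<open>z\<close> is a scalar \<open>c\<close> at some vertex of the support, the set of all vertices where it is this \<open>c\<close>
  will do.  Otherwise there is no sink in the support, and so there is a cycle; it has no exit, and its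
  vertices will do, since no vertex leading to them can be scalar.
\<close>

lemma reducing_set:
  assumes z: "z \<in> Z (verts G)" and ne: "support z \<noteq> {}"
  obtains W where "hereditary G W" "finite (Arr G W)" "W \<noteq> {}" "W \<subseteq> support z"
    "z * idem W \<in> linear_span A central_generators"
proof (cases "\<exists>v\<in>support z. \<exists>c. P v * z = K c * P v")
  case True
  then obtain v c where v: "v \<in> support z" "P v * z = K c * P v" by blast
  have "c \<noteq> 0"
    using v by (auto simp: support_def K_zero)
  define W where "W = {w \<in> verts G. P w * z = K c * P w}"
  have her: "hereditary G W"
    using scalar_along_path[OF z] by (auto simp: hereditary_def W_def)
  have sup: "W \<subseteq> support z"
    using \<open>c \<noteq> 0\<close> vertex_nonzero by (auto simp: W_def support_def K_eq_zero)
  have fin: "finite (Arr G W)"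
  proof (rule finite_Arr_of_support[OF z her sup])
    fix u p w d assume *: "w \<in> W" "awalk u p w" "P u * z = K d * P u"
    then have "K d * P w = K c * P w" and w: "w \<in> verts G"
      using scalar_along_path[OF z *(2,3)] by (simp_all add: W_def)
    then have "K (d - c) * P w = 0"
      using K_add[of d "- c"] by (simp add: K_uminus left_diff_distrib)
    then have "d = c"
      using vertex_nonzero[OF w] by (simp add: K_eq_zero)
    then show "u \<in> W" using * by (auto simp: W_def)
  qed
  have "z * idem W = (\<Sum>x\<in>Arr G W. K c * (case x of (u, p) \<Rightarrow> epath u p * gpath u p))"
    unfolding central_mult_idem[OF z]
  proof (intro sum.cong refl)
    fix x assume "x \<in> Arr G W"
    then obtain u p w where x: "x = (u, p)" "awalk u p w" "w \<in> W"
      using Arr_awalk by (cases x) blast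
    have "epath u p * z * gpath u p = epath u p * (P w * z) * gpath u p"
      using epath_target[OF x(2)] by (metis mult.assoc)
    also have "P w * z = K c * P w"
      using x(3) by (simp add: W_def)
    also have "epath u p * (K c * P w) * gpath u p = K c * (epath u p * P w * gpath u p)"
      by (simp only: K_assoc mult.assoc)
    finally show "(case x of (u, p) \<Rightarrow> epath u p * z * gpath u p) =
        K c * (case x of (u, p) \<Rightarrow> epath u p * gpath u p)"
      using x(1) epath_target[OF x(2)] by simp
  qed
  also have "\<dots> = K c * idem W"
    by (simp add: idem_def sum_distrib_left)
  finally have "z * idem W = K c * idem W" .
  moreover have "v \<in> W" using v by (simp add: W_def support_def)
  moreover from this have "idem W \<in> central_generators"
    unfolding central_generators_def finitary_def
    using her fin finite_of_Arr[OF fin] by (auto simp: W_def)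
  ultimately show ?thesis
    using that[OF her fin _ sup] by (auto intro: span_smult linear_span.incl)
next
  case False
  then have nonscalar: "P v * z \<noteq> K c * P v" if "v \<in> support z" for v c
    using that by blast
  have zL: "z \<in> L" using z by (simp add: Z_def)
  have sub: "support z \<subseteq> verts G" by (auto simp: support_def)
  obtain C where C: "cycle C" "cycle_verts G C \<subseteq> support z"
  proof (cases rule: sink_or_cycle[OF finite_support[OF zL] ne sub])
    case (1 v)
    then have v: "v \<in> verts G" using sub by blast
    have "out_arcs G v = {}"
      using successor_in_support[OF z 1(1)] 1(2) by metis
    then have "\<exists>c. P v * z = K c * P v"
      using corner_at_sink[OF v _ zL] central_vertex(1)[OF z v] by simp
    then show ?thesis using nonscalar[OF 1(1)] by blast
  qed (use that in blast)
  let ?W = "cycle_verts G C"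
  obtain w where w: "w \<in> ?W"
    using C(1) by (cases C) (auto simp: cycle_iff cycle_verts_def)
  have "w \<in> support z" using w C(2) by blast
  then have NE: "NE_cycle G C"
    using scalar_on_cycle[OF z C(1) _ w] nonscalar by blast
  have her: "hereditary G ?W" by (rule hereditary_NE_cycle[OF NE])
  have W: "?W \<subseteq> verts G" "finite ?W"
    using C(2) sub by (auto simp: cycle_verts_def)
  have fin: "finite (Arr G ?W)"
  proof (rule finite_Arr_of_support[OF z her C(2)])
    fix u p w c assume "w \<in> ?W" "awalk u p w" "P u * z = K c * P u"
    then have "P w * z = K c * P w" "w \<in> support z"
      using scalar_along_path[OF z] C(2) by auto
    then show "u \<in> ?W"
      using nonscalar by blast
  qed
  let ?y = "(\<Sum>v\<in>?W. P v) * z"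
  have "P v * z \<in> sub ?W" if "v \<in> ?W" for v
    using corner_in_sub[OF her that zL] central_vertex(1)[OF z, of v] that W(1) by auto
  then have y: "?y \<in> Z ?W"
    by (rule restrict_central[OF her W(2) z])
  have "spread ?W ?y = z * idem ?W"
    unfolding spread_def central_mult_idem[OF z]
    using Arr_unit[OF W(2,1)] by (intro sum.cong refl) (force simp flip: mult.assoc)
  moreover have "spread ?W ?y \<in> central_generators"
    unfolding central_generators_def finitary_def using NE her fin y
    by (intro UnI2 CollectI exI[of _ C] exI[of _ ?y]) simp
  ultimately have "z * idem ?W \<in> linear_span A central_generators"
    using linear_span.incl[of "spread ?W ?y" central_generators A] by simp
  then show ?thesis
    using that[OF her fin _ C(2)] w by blast
qed

lemma Z_diff: "z \<in> Z W \<Longrightarrow> z' \<in> Z W \<Longrightarrow> z - z' \<in> Z W"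
  by (simp add: Z_def sub_diff left_diff_distrib right_diff_distrib)

lemma Z_mult:
  assumes "z \<in> Z W" "z' \<in> Z W"
  shows "z * z' \<in> Z W"
proof -
  have zx: "z * x = x * z" "z' * x = x * z'" if "x \<in> sub W" for x
    using assms that by (simp_all add: Z_def)
  have "z * z' * x = x * (z * z')" if x: "x \<in> sub W" for x
  proof -
    have "z * z' * x = z * x * z'"
      by (simp only: zx(2)[OF x] mult.assoc)
    then show ?thesis
      by (simp only: zx(1)[OF x] mult.assoc)
  qed
  moreover have "z * z' \<in> sub W"
    using assms sub_mult unfolding Z_def by blast
  ultimately show ?thesis unfolding Z_def by blast
qed

text \<open>
  Induction on the size of the support, which drops when \<open>z e(W)\<close> is subtracted: \<open>z - z e(W)\<close> vanishes
  on \<open>W\<close>.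
\<close>

lemma Z_subset_span: "z \<in> Z (verts G) \<Longrightarrow> z \<in> linear_span A central_generators"
proof (induction "card (support z)" arbitrary: z rule: less_induct)
  case less
  have zL: "z \<in> L" using less.prems by (simp add: Z_def)
  show ?case
  proof (cases "support z = {}")
    case True
    then show ?thesis using zero_if_support_empty[OF zL] span_zero by simp
  next
    case False
    then obtain W where W: "hereditary G W" "finite (Arr G W)" "W \<noteq> {}" "W \<subseteq> support z"
      "z * idem W \<in> linear_span A central_generators"
      by (rule reducing_set[OF less.prems])
    let ?y = "z - z * idem W"
    have idem: "idem W \<in> Z (verts G)" by (rule idem_central[OF W(1,2)])
    have y: "?y \<in> Z (verts G)"
      using less.prems idem by (intro Z_diff Z_mult)
    have Py: "P v * ?y = P v * z - P v * z * idem W" for v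
      by (simp add: right_diff_distrib mult.assoc)
    have le: "support ?y \<subseteq> support z"
      unfolding support_def Py by auto
    obtain w where w: "w \<in> W" using W(3) by blast
    have wV: "w \<in> verts G" using w W(4) by (auto simp: support_def)
    have WV: "W \<subseteq> verts G" using W(1) by (simp add: hereditary_def)
    have Pw: "P w * idem W = P w"
    proof -
      have "P w * idem W = P w * (\<Sum>v\<in>W. P v) * P w"
        using idem_spread[OF finite_of_Arr[OF W(2) WV] WV] spread_vertex(1)[OF W(2) wV]
          fibre_in[OF w wV] by simp
      then show ?thesis
        using vertex_sum_mult(2)[OF finite_of_Arr[OF W(2) WV] WV wV] w vertex_idem[OF wV] by simp
    qed
    have "P w * z * idem W = z * (P w * idem W)"
      by (simp only: central_vertex(2)[OF less.prems wV, symmetric] mult.assoc)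
    then have "P w * ?y = 0"
      using central_vertex(2)[OF less.prems wV] unfolding Py Pw by simp
    then have "w \<notin> support ?y" "w \<in> support z"
      using w W(4) by (auto simp: support_def)
    with le have "support ?y \<subset> support z" by blast
    then have "card (support ?y) < card (support z)"
      using finite_support[OF zL] by (rule psubset_card_mono[rotated])
    then have "?y \<in> linear_span A central_generators"
      using less.hyps y by blast
    from span_add[OF this W(5)] show ?thesis by simp
  qed
qed

lemma central_generators_central: "central_generators \<subseteq> Z (verts G)"
  by (auto simp: central_generators_def finitary_def intro: idem_central spread_central)

theorem center_eq_span: "Z (verts G) = linear_span A central_generators"
proof
  show "linear_span A central_generators \<subseteq> Z (verts G)"
  proof
    fix x assume "x \<in> linear_span A central_generators"
    then show "x \<in> Z (verts G)"
    proof (induction rule: span_induct)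
      case (incl x)
      then show ?case using central_generators_central by blast
    next
      case (smult c x)
      have "K c * x * y = y * (K c * x)" if "y \<in> L" for y
      proof -
        have "K c * x * y = K c * (y * x)"
          using smult that by (simp add: Z_def mult.assoc)
        then show ?thesis by (simp only: K_assoc)
      qed
      then show ?case using smult by (simp add: Z_def sub_smult)
    qed (simp_all add: Z_def sub_zero sub_add distrib_left distrib_right)
  qed
qed (use Z_subset_span in blast)

end

section \<open>The Leavitt path algebra as a Leavitt family\<close>

text \<open>
  The argument \<open>field_type\<close> only fixes the type of scalars for all definitions of the locale.
\<close>

locale row_finite_digraph = wf_digraph G
  for G :: "('v, 'e) pre_digraph" +
  fixes field_type :: "'f::field itself"
  assumes row_finite: "row_finite G"
begin

abbreviation FN :: "(('v, 'e) generator, 'f) free_algebra set" where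
  "FN \<equiv> free_nonunital (generators G)"

definition proj :: "(('v, 'e) generator, 'f) free_algebra \<Rightarrow> (('v, 'e) generator, 'f) free_algebra quots"
  where "proj = quot_map (ideal_closure (generators G) (leavitt_relations G))"

lemma proj_hom:
  "proj 0 = 0" "proj (a + b) = proj a + proj b" "proj (a - b) = proj a - proj b" "proj (a * b) = proj a * proj b"
  "proj (c * a) = quots_const c * proj a" "proj (sum f I) = (\<Sum>i\<in>I. proj (f i))"
  unfolding proj_def by (rule quot_map_hom quot_map_sum)+

lemma proj_eq_iff:
  assumes "a \<in> FN" "b \<in> FN"
  shows "proj a = proj b \<longleftrightarrow> leavitt_class G a = leavitt_class G b"
  unfolding proj_def quot_map_eq_iff[OF two_sided_ideal_closure] leavitt_class_eq_iff
  using ideal_closure_Int_free_nonunital[OF leavitt_relations_subset[OF wf_digraph_axioms]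
      free_nonunital_diff[OF assms]] .

lemma proj_relation:
  assumes "a - b \<in> leavitt_relations G"
  shows "proj a = proj b"
proof -
  have "a - b \<in> ideal_closure (generators G) (leavitt_relations G)"
    unfolding ideal_closure_def
    using ideal_generated.incl[OF assms] two_sided_idealD(1)[OF alien_words_ideal] by force
  then show ?thesis
    by (simp add: proj_def quot_map_eq_iff[OF two_sided_ideal_closure])
qed

definition Kq :: "'f \<Rightarrow> (('v, 'e) generator, 'f) free_algebra quots" where
  "Kq c = quots_const (scalar c)"

definition Pq :: "'v \<Rightarrow> (('v, 'e) generator, 'f) free_algebra quots" where
  "Pq v = proj (monomial [Vertex v])"

definition Eq :: "'e \<Rightarrow> (('v, 'e) generator, 'f) free_algebra quots" where
  "Eq e = proj (monomial [Edge e])"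

definition Sq :: "'e \<Rightarrow> (('v, 'e) generator, 'f) free_algebra quots" where
  "Sq e = proj (monomial [Ghost e])"

lemma monomial_in_FN: "ws \<noteq> [] \<Longrightarrow> set ws \<subseteq> generators G \<Longrightarrow> monomial ws \<in> FN"
  by (rule free_nonunital_monomial)

sublocale leavitt_family G Kq Pq Eq Sq
proof
  show "Kq (a + b) = Kq a + Kq b" "Kq (a * b) = Kq a * Kq b" "Kq 1 = 1" for a b
    by (simp_all add: Kq_def scalar_add scalar_mult scalar_one quots_const_hom)
  show "x * Kq a = Kq a * x" for a x
    unfolding Kq_def by (rule quots_const_central[OF scalar_commute, symmetric])
  show "Pq v * Pq w = (if v = w then Pq v else 0)" if "v \<in> verts G" "w \<in> verts G" for v w
  proof -
    have "proj (monomial [Vertex v, Vertex w]) = proj (if v = w then monomial [Vertex v] else 0)"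
      using that by (intro proj_relation) (auto simp: leavitt_relations_def)
    then show ?thesis by (simp add: Pq_def monomial_mult proj_hom(1) flip: proj_hom(4))
  qed
  show "Pq (tail G e) * Eq e = Eq e" if "e \<in> arcs G" for e
  proof -
    have "proj (monomial [Vertex (tail G e), Edge e]) = proj (monomial [Edge e])"
      using that by (intro proj_relation) (auto simp: leavitt_relations_def)
    then show ?thesis by (simp add: Pq_def Eq_def monomial_mult flip: proj_hom(4))
  qed
  show "Eq e * Pq (head G e) = Eq e" if "e \<in> arcs G" for e
  proof -
    have "proj (monomial [Edge e, Vertex (head G e)]) = proj (monomial [Edge e])"
      using that by (intro proj_relation) (auto simp: leavitt_relations_def)
    then show ?thesis by (simp add: Pq_def Eq_def monomial_mult flip: proj_hom(4))
  qed
  show "Pq (head G e) * Sq e = Sq e" if "e \<in> arcs G" for e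
  proof -
    have "proj (monomial [Vertex (head G e), Ghost e]) = proj (monomial [Ghost e])"
      using that by (intro proj_relation) (auto simp: leavitt_relations_def)
    then show ?thesis by (simp add: Pq_def Sq_def monomial_mult flip: proj_hom(4))
  qed
  show "Sq e * Pq (tail G e) = Sq e" if "e \<in> arcs G" for e
  proof -
    have "proj (monomial [Ghost e, Vertex (tail G e)]) = proj (monomial [Ghost e])"
      using that by (intro proj_relation) (auto simp: leavitt_relations_def)
    then show ?thesis by (simp add: Pq_def Sq_def monomial_mult flip: proj_hom(4))
  qed
  show "Sq e * Eq f = (if e = f then Pq (head G e) else 0)" if "e \<in> arcs G" "f \<in> arcs G" for e f
  proof -
    have "proj (monomial [Ghost e, Edge f]) = proj (if e = f then monomial [Vertex (head G e)] else 0)"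
      using that by (intro proj_relation) (auto simp: leavitt_relations_def)
    then show ?thesis by (simp add: Pq_def Eq_def Sq_def monomial_mult proj_hom(1) flip: proj_hom(4))
  qed
  show "Pq v = (\<Sum>e\<in>out_arcs G v. Eq e * Sq e)" if "v \<in> verts G" "out_arcs G v \<noteq> {}" for v
  proof -
    have "proj (monomial [Vertex v]) = proj (\<Sum>e\<in>out_arcs G v. monomial [Edge e, Ghost e])"
    proof (rule proj_relation)
      show "monomial [Vertex v] - (\<Sum>e\<in>out_arcs G v. monomial [Edge e, Ghost e])
          \<in> leavitt_relations G"
        unfolding leavitt_relations_def using that by (intro UnI2) blast
    qed
    then show ?thesis
      by (simp add: Pq_def Eq_def Sq_def monomial_mult proj_hom(6) flip: proj_hom(4))
  qed
  show "Pq v \<noteq> 0" if v: "v \<in> verts G" for v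
  proof
    assume "Pq v = 0"
    then have "proj (monomial [Vertex v]) = proj 0"
      by (simp add: Pq_def proj_hom)
    moreover have "monomial [Vertex v] \<in> FN"
      using v by (intro monomial_in_FN) (auto simp: generators_def)
    ultimately have "leavitt_class G (monomial [Vertex v] :: (('v, 'e) generator, 'f) free_algebra) =
        leavitt_class G 0"
      using proj_eq_iff free_nonunital_zero by blast
    then show False
      by (simp add: leavitt_class_eq_iff vertex_not_in_ideal[OF wf_digraph_axioms row_finite])
  qed
  show "finite (out_arcs G v)" if "v \<in> verts G" for v
    using row_finite that by (simp add: row_finite_def)
qed

lemma Kq_mult: "Kq c * proj a = proj (scalar c * a)"
  by (simp add: Kq_def proj_hom(5))

lemma monomial_in_L:
  assumes "ws \<noteq> []" "set ws \<subseteq> generators G"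
  shows "proj (monomial ws) \<in> L"
  using assms
proof (induction ws rule: list_nonempty_induct)
  case (single g)
  then have "g \<in> generators G" by simp
  then show ?case
    unfolding generators_def
    by (auto simp flip: Pq_def Eq_def Sq_def intro!: sub_vertex sub_edge sub_ghost)
next
  case (cons g ws)
  then have "g \<in> generators G" by simp
  then have "proj (monomial [g]) \<in> L"
    unfolding generators_def
    by (auto simp flip: Pq_def Eq_def Sq_def intro!: sub_vertex sub_edge sub_ghost)
  then have "proj (monomial [g]) * proj (monomial ws) \<in> L"
    using cons by (intro sub_mult) auto
  then show ?case by (simp add: monomial_mult flip: proj_hom(4))
qed

lemma L_eq: "L = proj ` FN"
proof
  show "L \<subseteq> proj ` FN"
  proof
    fix x assume "x \<in> L"
    then show "x \<in> proj ` FN"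
    proof (induction rule: sub_induct)
      case zero
      show ?case using imageI[OF free_nonunital_zero, of proj] by (simp only: proj_hom(1))
    next
      case (vertex v)
      then have "monomial [Vertex v] \<in> FN"
        by (intro monomial_in_FN) (auto simp: generators_def)
      then show ?case by (auto simp: Pq_def)
    next
      case (edge e)
      then have "monomial [Edge e] \<in> FN"
        by (intro monomial_in_FN) (auto simp: generators_def)
      then show ?case by (auto simp: Eq_def)
    next
      case (ghost e)
      then have "monomial [Ghost e] \<in> FN"
        by (intro monomial_in_FN) (auto simp: generators_def)
      then show ?case by (auto simp: Sq_def)
    next
      case (add x y)
      then obtain a b where "x = proj a" "y = proj b" "a + b \<in> FN"
        using free_nonunital_add by blast
      then show ?case using imageI[of "a + b" FN proj] by (simp only: proj_hom(2))
    next
      case (smult c x)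
      then obtain a where "x = proj a" "scalar c * a \<in> FN"
        using free_nonunital_scalar by blast
      then show ?case using imageI[of "scalar c * a" FN proj] by (simp only: Kq_mult)
    next
      case (mult x y)
      then obtain a b where "x = proj a" "y = proj b" "a * b \<in> FN"
        using free_nonunital_mult by blast
      then show ?case using imageI[of "a * b" FN proj] by (simp only: proj_hom(4))
    qed
  qed
  show "proj ` FN \<subseteq> L"
  proof clarify
    fix a assume a: "a \<in> FN"
    have sum: "a = (\<Sum>w\<in>Poly_Mapping.keys a. scalar (Poly_Mapping.lookup a w) * monomial (letters w))"
      unfolding single_scalar_monomial[symmetric]
      by (intro poly_mapping_eqI) (simp add: lookup_sum lookup_single when_def in_keys_iff)
    have "proj (scalar (Poly_Mapping.lookup a w) * monomial (letters w)) \<in> L"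
      if "w \<in> Poly_Mapping.keys a" for w
      unfolding Kq_mult[symmetric] using a that
      by (intro sub_smult monomial_in_L) (auto simp: free_nonunital_def)
    then show "proj a \<in> L"
      by (subst sum, unfold proj_hom(6)) (rule sub_sum)
  qed
qed

section \<open>Transfer to the quotient algebra\<close>

text \<open>
  The isomorphism from the concrete family to the quotient algebra, defined through an arbitrary
  representative.
\<close>

definition cls :: "(('v, 'e) generator, 'f) free_algebra quots \<Rightarrow> (('v, 'e) generator, 'f) free_algebra set"
  where "cls x = leavitt_class G (SOME a. a \<in> FN \<and> proj a = x)"

lemma cls_proj:
  assumes "a \<in> FN"
  shows "cls (proj a) = leavitt_class G a"
proof -
  let ?b = "SOME b. b \<in> FN \<and> proj b = proj a"
  have b: "?b \<in> FN \<and> proj ?b = proj a"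
    by (rule someI[of _ a]) (simp add: assms)
  have "leavitt_class G ?b = leavitt_class G a"
    using b by (intro iffD1[OF proj_eq_iff[OF _ assms]]) (rule conjunct1 conjunct2, assumption)+
  then show ?thesis by (simp only: cls_def)
qed

abbreviation LG :: "('f, (('v, 'e) generator, 'f) free_algebra set) module" where
  "LG \<equiv> leavitt G"

lemma cls_zero: "cls 0 = \<zero>\<^bsub>LG\<^esub>"
  using cls_proj[OF free_nonunital_zero] by (simp only: proj_hom(1) leavitt_zero)

lemma cls_hom:
  assumes "x \<in> L" "y \<in> L"
  shows "cls (x + y) = cls x \<oplus>\<^bsub>LG\<^esub> cls y" "cls (x * y) = cls x \<otimes>\<^bsub>LG\<^esub> cls y"
proof -
  obtain a b where ab: "x = proj a" "a \<in> FN" "y = proj b" "b \<in> FN"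
    using assms unfolding L_eq by blast
  then show "cls (x + y) = cls x \<oplus>\<^bsub>LG\<^esub> cls y"
    by (simp add: cls_proj free_nonunital_add leavitt_add flip: proj_hom(2))
  show "cls (x * y) = cls x \<otimes>\<^bsub>LG\<^esub> cls y"
    using ab by (simp add: cls_proj free_nonunital_mult leavitt_mult[OF wf_digraph_axioms] flip: proj_hom(4))
qed

lemma cls_smult:
  assumes "x \<in> L"
  shows "cls (Kq c * x) = c \<odot>\<^bsub>LG\<^esub> cls x"
proof -
  obtain a where "x = proj a" "a \<in> FN"
    using assms unfolding L_eq by blast
  then show ?thesis
    by (simp add: cls_proj free_nonunital_scalar leavitt_smult Kq_mult)
qed

lemma cls_inj: "inj_on cls L"
  unfolding L_eq by (auto simp: inj_on_def cls_proj proj_eq_iff)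

lemma cls_carrier: "cls ` L = carrier LG"
  unfolding L_eq leavitt_carrier by (auto simp: cls_proj image_image)

lemma cls_commute_iff:
  assumes "x \<in> L" "y \<in> L"
  shows "cls x \<otimes>\<^bsub>LG\<^esub> cls y = cls y \<otimes>\<^bsub>LG\<^esub> cls x \<longleftrightarrow> x * y = y * x"
  using assms cls_inj by (simp add: sub_mult inj_on_eq_iff flip: cls_hom(2))

lemma cls_centralizer:
  assumes "T \<subseteq> L"
  shows "{z \<in> cls ` T. \<forall>x\<in>cls ` T. z \<otimes>\<^bsub>LG\<^esub> x = x \<otimes>\<^bsub>LG\<^esub> z} = cls ` {z \<in> T. \<forall>x\<in>T. z * x = x * z}"
proof -
  have "(\<forall>x\<in>cls ` T. cls z \<otimes>\<^bsub>LG\<^esub> x = x \<otimes>\<^bsub>LG\<^esub> cls z) \<longleftrightarrow> (\<forall>x\<in>T. z * x = x * z)" if "z \<in> T" for z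
    unfolding ball_simps using assms that cls_commute_iff by blast
  then show ?thesis by blast
qed

lemma cls_center: "center LG = cls ` Z (verts G)"
  unfolding center_def Z_def cls_carrier[symmetric] by (rule cls_centralizer) simp

lemma cls_subalgebra:
  assumes "T \<subseteq> L"
  shows "subalgebra_generated A T \<subseteq> L"
    and "subalgebra_generated LG (cls ` T) = cls ` subalgebra_generated A T"
proof -
  show sub: "subalgebra_generated A T \<subseteq> L"
  proof
    fix x assume "x \<in> subalgebra_generated A T"
    then show "x \<in> L"
      by induction (use assms in \<open>auto intro: sub_zero sub_add sub_smult sub_mult\<close>)
  qed
  show "subalgebra_generated LG (cls ` T) = cls ` subalgebra_generated A T"
  proof
    show "subalgebra_generated LG (cls ` T) \<subseteq> cls ` subalgebra_generated A T"
    proof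
      fix X assume "X \<in> subalgebra_generated LG (cls ` T)"
      then show "X \<in> cls ` subalgebra_generated A T"
      proof induction
        case zero
        show ?case
          using imageI[OF subalgebra_generated.zero[of A T], of cls] by (simp add: cls_zero)
      next
        case (incl X)
        then show ?case by (auto intro: subalgebra_generated.incl)
      next
        case (add X Y)
        then obtain x y where xy: "X = cls x" "Y = cls y" "x \<in> subalgebra_generated A T"
          "y \<in> subalgebra_generated A T" by blast
        then have "X \<oplus>\<^bsub>LG\<^esub> Y = cls (x + y)"
          using cls_hom(1)[OF subsetD[OF sub xy(3)] subsetD[OF sub xy(4)]] by simp
        then show ?case using subalgebra_generated.add[OF xy(3,4)] by simp
      next
        case (smult X c)
        then obtain x where x: "X = cls x" "x \<in> subalgebra_generated A T" by blast
        then have "c \<odot>\<^bsub>LG\<^esub> X = cls (Kq c * x)"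
          using cls_smult[OF subsetD[OF sub x(2)]] by simp
        then show ?case using subalgebra_generated.smult[OF x(2)] by simp
      next
        case (mult X Y)
        then obtain x y where xy: "X = cls x" "Y = cls y" "x \<in> subalgebra_generated A T"
          "y \<in> subalgebra_generated A T" by blast
        then have "X \<otimes>\<^bsub>LG\<^esub> Y = cls (x * y)"
          using cls_hom(2)[OF subsetD[OF sub xy(3)] subsetD[OF sub xy(4)]] by simp
        then show ?case using subalgebra_generated.mult[OF xy(3,4)] by simp
      qed
    qed
    show "cls ` subalgebra_generated A T \<subseteq> subalgebra_generated LG (cls ` T)"
    proof clarify
      fix x assume "x \<in> subalgebra_generated A T"
      then show "cls x \<in> subalgebra_generated LG (cls ` T)"
      proof induction
        case zero
        show ?case using subalgebra_generated.zero[of LG "cls ` T"] by (simp add: cls_zero)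
      next
        case (incl x)
        then show ?case by (simp add: subalgebra_generated.incl)
      next
        case (add x y)
        then show ?case
          using cls_hom(1)[OF subsetD[OF sub] subsetD[OF sub]] by (simp add: subalgebra_generated.add)
      next
        case (smult x c)
        then show ?case
          using cls_smult[OF subsetD[OF sub]] by (simp add: subalgebra_generated.smult)
      next
        case (mult x y)
        then show ?case
          using cls_hom(2)[OF subsetD[OF sub] subsetD[OF sub]] by (simp add: subalgebra_generated.mult)
      qed
    qed
  qed
qed

lemma cls_span:
  assumes "T \<subseteq> L"
  shows "linear_span LG (cls ` T) = cls ` linear_span A T"
proof -
  have sub: "linear_span A T \<subseteq> L"
  proof
    fix x assume "x \<in> linear_span A T"
    then show "x \<in> L"
      by (induction rule: span_induct) (use assms in \<open>auto intro: sub_zero sub_add sub_smult\<close>)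
  qed
  show ?thesis
  proof
    show "linear_span LG (cls ` T) \<subseteq> cls ` linear_span A T"
    proof
      fix X assume "X \<in> linear_span LG (cls ` T)"
      then show "X \<in> cls ` linear_span A T"
      proof induction
        case zero
        show ?case using imageI[OF span_zero[of T], of cls] by (simp add: cls_zero)
      next
        case (incl X)
        then show ?case by (auto intro: linear_span.incl)
      next
        case (add X Y)
        then obtain x y where xy: "X = cls x" "Y = cls y" "x \<in> linear_span A T"
          "y \<in> linear_span A T" by blast
        then have "X \<oplus>\<^bsub>LG\<^esub> Y = cls (x + y)"
          using cls_hom(1)[OF subsetD[OF sub xy(3)] subsetD[OF sub xy(4)]] by simp
        then show ?case using span_add[OF xy(3,4)] by simp
      next
        case (smult X c)
        then obtain x where x: "X = cls x" "x \<in> linear_span A T" by blast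
        then have "c \<odot>\<^bsub>LG\<^esub> X = cls (Kq c * x)"
          using cls_smult[OF subsetD[OF sub x(2)]] by simp
        then show ?case using span_smult[OF x(2)] by simp
      qed
    qed
    show "cls ` linear_span A T \<subseteq> linear_span LG (cls ` T)"
    proof clarify
      fix x assume "x \<in> linear_span A T"
      then show "cls x \<in> linear_span LG (cls ` T)"
      proof induction
        case zero
        show ?case using linear_span.zero[of LG "cls ` T"] by (simp add: cls_zero)
      next
        case (incl x)
        then show ?case by (simp add: linear_span.incl)
      next
        case (add x y)
        then show ?case
          using cls_hom(1)[OF subsetD[OF sub] subsetD[OF sub]] by (simp add: linear_span.add)
      next
        case (smult x c)
        then show ?case
          using cls_smult[OF subsetD[OF sub]] by (simp add: linear_span.smult)
      qed
    qed
  qed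
qed

lemma cls_center_sub:
  assumes "W \<subseteq> verts G"
  shows "center (leavitt_sub G W :: ('f, _) module) = cls ` Z W"
proof -
  let ?X = "Vertex ` W \<union> (\<Union>e\<in>{e \<in> arcs G. tail G e \<in> W \<and> head G e \<in> W}. {Edge e, Ghost e})"
  have X: "?X \<subseteq> generators G"
    using assms by (auto simp: generators_def)
  have "gens W = proj ` monomial ` (\<lambda>g. [g]) ` ?X"
    unfolding gens_def by (simp add: image_Un image_UN image_image Pq_def Eq_def Sq_def)
  moreover have "cls ` proj ` monomial ` (\<lambda>g. [g]) ` ?X = leavitt_class G ` monomial ` (\<lambda>g. [g]) ` ?X"
    unfolding image_image using X by (intro image_cong refl cls_proj monomial_in_FN) auto
  ultimately have gens: "cls ` gens W = leavitt_class G ` monomial ` (\<lambda>g. [g]) ` ?X"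
    by simp
  have "gens W \<subseteq> L"
    using assms by (auto simp: gens_def intro!: sub_vertex sub_edge sub_ghost)
  from cls_subalgebra[OF this]
  have sub: "sub W \<subseteq> L" and alg: "subalgebra_generated LG (cls ` gens W) = cls ` sub W"
    by (simp_all add: sub_def)
  have "center (leavitt_sub G W :: ('f, _) module) =
      {z \<in> cls ` sub W. \<forall>x\<in>cls ` sub W. z \<otimes>\<^bsub>LG\<^esub> x = x \<otimes>\<^bsub>LG\<^esub> z}"
    unfolding center_def leavitt_sub_def gens[symmetric] alg by simp
  also have "\<dots> = cls ` Z W"
    unfolding Z_def by (rule cls_centralizer[OF sub])
  finally show ?thesis .
qed

lemma cls_sum:
  assumes "finite I" "\<And>i. i \<in> I \<Longrightarrow> f i \<in> L"
  shows "(\<Oplus>\<^bsub>LG\<^esub>i\<in>I. cls (f i)) = cls (\<Sum>i\<in>I. f i)"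
proof -
  interpret LG: abelian_group LG by (rule abelian_group_leavitt)
  show ?thesis
    using assms
  proof (induction rule: finite_induct)
    case (insert i I)
    moreover have "cls (f j) \<in> carrier LG" if "j \<in> insert i I" for j
      using insert(4)[OF that] cls_carrier by blast
    ultimately show ?case
      by (simp add: LG.finsum_insert Pi_def cls_hom(1) sub_sum)
  qed (simp add: cls_zero)
qed

lemma cls_path:
  assumes "awalk u p w"
  shows "cls (epath u p) = path_elem G (u, p)" "cls (gpath u p) = path_star G (u, p)"
proof -
  have Eq_monomial: "Eq e * proj (monomial ws) = proj (monomial (Edge e # ws))" for e ws
    by (simp add: Eq_def monomial_mult flip: proj_hom(4))
  have monomial_Sq: "proj (monomial ws) * Sq e = proj (monomial (ws @ [Ghost e]))" for e ws
    by (simp add: Sq_def monomial_mult flip: proj_hom(4))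
  have nonempty: "epath (tail G e) (e # p) = proj (monomial (map Edge (e # p))) \<and>
      gpath (tail G e) (e # p) = proj (monomial (map Ghost (rev (e # p))))"
    if "awalk (head G e) p w" "e \<in> arcs G" for e p
    using that
  proof (induction p arbitrary: e)
    case Nil
    then show ?case
      using edge_head[of e] head_ghost[of e] by (simp, simp add: Eq_def Sq_def)
  next
    case (Cons f p)
    then have "head G e = tail G f" by (simp add: awalk_simps)
    with Cons show ?case
      using Cons.IH[of f] epath.simps(2)[of "tail G e" e "f # p"] gpath.simps(2)[of "tail G e" e "f # p"]
      by (simp add: awalk_simps Eq_monomial monomial_Sq del: epath.simps gpath.simps)
  qed
  have eq: "epath u p = proj (monomial (if p = [] then [Vertex u] else map Edge p))"
    "gpath u p = proj (monomial (if p = [] then [Vertex u] else map Ghost (rev p)))"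
    using assms nonempty by (cases p; simp add: awalk_simps Pq_def del: epath.simps(2) gpath.simps(2))+
  have "u \<in> verts G" "set p \<subseteq> arcs G" using assms by auto
  then have "monomial (if p = [] then [Vertex u] else map Edge p) \<in> FN"
    "monomial (if p = [] then [Vertex u] else map Ghost (rev p)) \<in> FN"
    by (intro monomial_in_FN; auto simp: generators_def)+
  then show "cls (epath u p) = path_elem G (u, p)" "cls (gpath u p) = path_star G (u, p)"
    by (simp_all only: eq cls_proj path_elem.simps path_star.simps)
qed

lemma cls_idem:
  assumes "finite (Arr G W)"
  shows "cls (idem W) = arrival_idempotent G W"
proof -
  interpret LG: abelian_group LG by (rule abelian_group_leavitt)
  let ?f = "\<lambda>(u, p). epath u p * gpath u p"
  have f: "?f x \<in> L \<and> cls (?f x) = path_elem G x \<otimes>\<^bsub>LG\<^esub> path_star G x" if x: "x \<in> Arr G W" for x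
  proof -
    obtain u p w where "x = (u, p)" "awalk u p w"
      using Arr_awalk x by (cases x) blast
    then show ?thesis
      using path_in_L cls_path by (simp add: sub_mult cls_hom(2) del: path_elem.simps path_star.simps)
  qed
  have "cls (idem W) = (\<Oplus>\<^bsub>LG\<^esub>x\<in>Arr G W. cls (?f x))"
    unfolding idem_def using f by (intro cls_sum[symmetric] assms) blast
  also have "\<dots> = arrival_idempotent G W"
    unfolding arrival_idempotent_def
    using f cls_carrier by (intro LG.finsum_cong') (auto simp del: path_elem.simps path_star.simps, blast)
  finally show ?thesis .
qed

lemma cls_spread:
  assumes "finite (Arr G W)" "z \<in> L"
  shows "cls (spread W z) =
    (\<Oplus>\<^bsub>LG\<^esub>p\<in>Arr G W. path_elem G p \<otimes>\<^bsub>LG\<^esub> cls z \<otimes>\<^bsub>LG\<^esub> path_star G p)"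
proof -
  interpret LG: abelian_group LG by (rule abelian_group_leavitt)
  let ?f = "\<lambda>(u, p). epath u p * z * gpath u p"
  have f: "?f x \<in> L \<and> cls (?f x) = path_elem G x \<otimes>\<^bsub>LG\<^esub> cls z \<otimes>\<^bsub>LG\<^esub> path_star G x"
    if x: "x \<in> Arr G W" for x
  proof -
    obtain u p w where "x = (u, p)" "awalk u p w"
      using Arr_awalk x by (cases x) blast
    then show ?thesis
      using path_in_L cls_path assms(2)
      by (simp add: sub_mult cls_hom(2) del: path_elem.simps path_star.simps)
  qed
  have "cls (spread W z) = (\<Oplus>\<^bsub>LG\<^esub>x\<in>Arr G W. cls (?f x))"
    unfolding spread_def using f by (intro cls_sum[symmetric] assms) blast
  also have "\<dots> = (\<Oplus>\<^bsub>LG\<^esub>p\<in>Arr G W. path_elem G p \<otimes>\<^bsub>LG\<^esub> cls z \<otimes>\<^bsub>LG\<^esub> path_star G p)"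
    using f cls_carrier by (intro LG.finsum_cong') (auto simp del: path_elem.simps path_star.simps, blast)
  finally show ?thesis .
qed

lemma cls_central_generators:
  "cls ` central_generators =
     {arrival_idempotent G W | W. finite W \<and> W \<noteq> {} \<and> finitary G W}
   \<union> {\<Oplus>\<^bsub>LG\<^esub> p\<in>Arr G (cycle_verts G C). path_elem G p \<otimes>\<^bsub>LG\<^esub> z \<otimes>\<^bsub>LG\<^esub> path_star G p | C z.
        NE_cycle G C \<and> finitary G (cycle_verts G C) \<and> z \<in> center (leavitt_sub G (cycle_verts G C))}"
  (is "_ = ?I \<union> ?S")
proof -
  have "cls ` {idem W | W. finite W \<and> W \<noteq> {} \<and> finitary G W} = ?I"
    unfolding setcompr_eq_image image_image
    by (intro image_cong refl) (simp add: cls_idem finitary_def)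
  moreover have "cls ` {spread (cycle_verts G C) z | C z. NE_cycle G C \<and>
      finitary G (cycle_verts G C) \<and> z \<in> Z (cycle_verts G C)} = ?S"
  proof -
    have cen: "center (leavitt_sub G (cycle_verts G C) :: ('f, _) module) = cls ` Z (cycle_verts G C)"
      "Z (cycle_verts G C) \<subseteq> L" if "finitary G (cycle_verts G C)" for C
      using that cls_center_sub sub_mono[of "cycle_verts G C" "verts G"]
      by (auto simp: finitary_def hereditary_def Z_def)
    have spr: "cls (spread (cycle_verts G C) z) = (\<Oplus>\<^bsub>LG\<^esub> p\<in>Arr G (cycle_verts G C).
        path_elem G p \<otimes>\<^bsub>LG\<^esub> cls z \<otimes>\<^bsub>LG\<^esub> path_star G p)"
      if "finitary G (cycle_verts G C)" "z \<in> Z (cycle_verts G C)" for C z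
      using cls_spread[of "cycle_verts G C" z] cen(2)[OF that(1)] that by (auto simp: finitary_def)
    show ?thesis
    proof (intro equalityI subsetI)
      fix X assume "X \<in> cls ` {spread (cycle_verts G C) z | C z. NE_cycle G C \<and>
        finitary G (cycle_verts G C) \<and> z \<in> Z (cycle_verts G C)}"
      then obtain C z where "X = cls (spread (cycle_verts G C) z)" "NE_cycle G C"
        "finitary G (cycle_verts G C)" "z \<in> Z (cycle_verts G C)" by blast
      then show "X \<in> ?S"
        using spr cen(1) by (intro CollectI exI[of _ C] exI[of _ "cls z"] conjI) auto
    next
      fix X assume "X \<in> ?S"
      then obtain C y where X: "X = (\<Oplus>\<^bsub>LG\<^esub> p\<in>Arr G (cycle_verts G C).
          path_elem G p \<otimes>\<^bsub>LG\<^esub> y \<otimes>\<^bsub>LG\<^esub> path_star G p)" and C: "NE_cycle G C"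
        "finitary G (cycle_verts G C)" "y \<in> center (leavitt_sub G (cycle_verts G C))" by blast
      then obtain z where z: "y = cls z" "z \<in> Z (cycle_verts G C)"
        using cen(1) by blast
      then have "X = cls (spread (cycle_verts G C) z)"
        using spr[OF C(2)] X by simp
      then show "X \<in> cls ` {spread (cycle_verts G C) z | C z. NE_cycle G C \<and>
        finitary G (cycle_verts G C) \<and> z \<in> Z (cycle_verts G C)}"
        using C z by blast
    qed
  qed
  ultimately show ?thesis
    unfolding central_generators_def image_Un by simp
qed

end

theorem theorem3:
  fixes G :: "('v, 'e) pre_digraph"
  assumes "wf_digraph G" and "row_finite G"
  shows "center (leavitt G :: ('f::field, (('v, 'e) generator, 'f) free_algebra set) module) =
    subspace_sum (leavitt G)
      ({range (\<lambda>c. c \<odot>\<^bsub>leavitt G\<^esub> arrival_idempotent G W) | W.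
          W \<subseteq> verts G \<and> finite W \<and> W \<noteq> {} \<and> hereditary G W \<and> finitary G W}
     \<union> {linear_span (leavitt G)
          {\<Oplus>\<^bsub>leavitt G\<^esub> p\<in>Arr G (cycle_verts G C).
              path_elem G p \<otimes>\<^bsub>leavitt G\<^esub> z \<otimes>\<^bsub>leavitt G\<^esub> path_star G p | z.
            z \<in> center (leavitt_sub G (cycle_verts G C))} | C.
          NE_cycle G C \<and> finitary G (cycle_verts G C)})"
proof -
  interpret row_finite_digraph G "TYPE('f)"
    using assms by (simp add: row_finite_digraph_def row_finite_digraph_axioms_def)
  let ?a = "\<lambda>W. range (\<lambda>c. c \<odot>\<^bsub>LG\<^esub> arrival_idempotent G W)"
  let ?b = "\<lambda>C. {\<Oplus>\<^bsub>LG\<^esub> p\<in>Arr G (cycle_verts G C).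
    path_elem G p \<otimes>\<^bsub>LG\<^esub> z \<otimes>\<^bsub>LG\<^esub> path_star G p | z.
      z \<in> center (leavitt_sub G (cycle_verts G C))}"
  let ?A = "{?a W | W. W \<subseteq> verts G \<and> finite W \<and> W \<noteq> {} \<and> hereditary G W \<and> finitary G W}"
  let ?B = "{linear_span LG (?b C) | C. NE_cycle G C \<and> finitary G (cycle_verts G C)}"
  let ?S = "cls ` central_generators"
  have gens: "central_generators \<subseteq> L"
    using central_generators_central by (auto simp: Z_def)
  have her: "hereditary G W \<and> W \<subseteq> verts G" if "finitary G W" for W
    using that by (simp add: finitary_def hereditary_def)
  let ?U = "\<Union> (?A \<union> ?B)"
  have idem_U: "arrival_idempotent G W \<in> ?U" if W: "finite W" "W \<noteq> {}" "finitary G W" for W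
  proof (rule UnionI)
    show "?a W \<in> ?A \<union> ?B"
      using W her[OF W(3)] by (intro UnI1 CollectI exI[of _ W]) simp
    have "idem W \<in> L"
      using idem_central[of W] W(3) by (simp add: finitary_def Z_def)
    then have "arrival_idempotent G W = 1 \<odot>\<^bsub>LG\<^esub> arrival_idempotent G W"
      using cls_smult[of "idem W" 1] cls_idem[of W] W(3) by (simp add: finitary_def K_one)
    then show "arrival_idempotent G W \<in> ?a W" by (rule range_eqI)
  qed
  have spread_U: "X \<in> ?U" if C: "NE_cycle G C" "finitary G (cycle_verts G C)" and X: "X \<in> ?b C" for C X
  proof (rule UnionI)
    show "linear_span LG (?b C) \<in> ?A \<union> ?B"
      using C by (intro UnI2 CollectI exI[of _ C]) simp
    show "X \<in> linear_span LG (?b C)"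
      using X by (rule linear_span.incl)
  qed
  have "?S \<subseteq> ?U"
    unfolding cls_central_generators
  proof (intro Un_least subsetI; elim CollectE exE conjE)
    fix X :: "(('v, 'e) generator, 'f) free_algebra set" and W
    assume "X = arrival_idempotent G W" "finite W" "W \<noteq> {}" "finitary G W"
    then show "X \<in> ?U" using idem_U by simp
  next
    fix X :: "(('v, 'e) generator, 'f) free_algebra set" and C z
    assume X: "X = (\<Oplus>\<^bsub>LG\<^esub> p\<in>Arr G (cycle_verts G C).
        path_elem G p \<otimes>\<^bsub>LG\<^esub> z \<otimes>\<^bsub>LG\<^esub> path_star G p)"
      and C: "NE_cycle G C" "finitary G (cycle_verts G C)"
      and z: "z \<in> center (leavitt_sub G (cycle_verts G C))"
    show "X \<in> ?U"
      by (rule spread_U[OF C]) (intro CollectI exI[of _ z] conjI X z)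
  qed
  then have le: "linear_span LG ?S \<subseteq> linear_span LG ?U"
    by (rule linear_span_mono)
  have "?U \<subseteq> linear_span LG ?S"
  proof (intro Union_least; elim UnE CollectE exE conjE)
    fix T :: "(('v, 'e) generator, 'f) free_algebra set set" and W
    assume T: "T = ?a W" and W: "finite W" "W \<noteq> {}" "finitary G W"
    have "arrival_idempotent G W \<in> ?S"
      unfolding cls_central_generators using W by (intro UnI1 CollectI exI[of _ W]) simp
    then show "T \<subseteq> linear_span LG ?S"
      unfolding T by (intro image_subsetI linear_span.smult linear_span.incl)
  next
    fix T :: "(('v, 'e) generator, 'f) free_algebra set set" and C
    assume T: "T = linear_span LG (?b C)"
      and C: "NE_cycle G C" "finitary G (cycle_verts G C)"
    have "?b C \<subseteq> ?S"
      unfolding cls_central_generators using C by (intro le_supI2 Collect_mono) blast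
    then show "T \<subseteq> linear_span LG ?S"
      unfolding T by (rule linear_span_mono)
  qed
  then have "linear_span LG ?U \<subseteq> linear_span LG ?S"
    by (rule linear_span_minimal)
  with le have "linear_span LG ?S = linear_span LG ?U"
    by (rule equalityI)
  then show ?thesis
    unfolding cls_center center_eq_span cls_span[OF gens, symmetric] subspace_sum_def .
qed

end
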